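(* Let $n\ge 0$, $d\ge 2$ be integers and let $T\in\mathrm{Sym}^d\mathbb{C}^{n+1}$. Then $\mathrm{sgr}(T)\leq \mathrm{GR}(T)$.
   Context: For $T=(t_{i_1,\dots,i_d})\in \mathrm{Sym}^d\mathbb{C}^{n+1}$ (coordinates with respect to the canonical basis), the associated homogeneous degree $d$ polynomial is $F(x)=\sum t_{i_1,\dots,i_d}x_{i_1}\cdots x_{i_d}\in\mathbb{C}[x_0,\dots,x_n]_d$. The symmetric geometric rank is $\mathrm{sgr}(T)=\mathrm{codim}\{x\in\mathbb{C}^{n+1} : \frac{\partial F}{\partial x_0}(x)=\cdots=\frac{\partial F}{\partial x_n}(x)=0\}$ (codimension in $\mathbb{C}^{n+1}$); equivalently, it is the codimension in $\mathbb{P}^n$ of the singular locus of $F$, with the convention that the empty set has codimension $n+1$ in $\mathbb{P}^n$. A tensor $T\in(\mathbb{C}^{n+1})^{\otimes d}$ is also viewed as a multilinear polynomial $T(x_1,\dots,x_d)$ in $d$ groups of variables $x_i\in\mathbb{C}^{n+1}$. The geometric rank of $T$ is $\mathrm{GR}(T)=\mathrm{codim}\{(x_1,\dots,x_{d-1})\in(\mathbb{C}^{n+1})^{d-1} : T(x_1,\dots,x_d)=0\ \text{for all } x_d\in\mathbb{C}^{n+1}\}$, the codimension being taken in $(\mathbb{C}^{n+1})^{d-1}$. *)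

theory Defs
  imports
    Complex_Main
    "HOL-Library.FuncSet"
    "HOL-Library.Extended_Nat"
    "HOL-Library.Poly_Mapping"
    "HOL-Combinatorics.Permutations"
begin

text \<open>
  A polynomial with complex coefficients is a finitely supported map from monomials to
  coefficients, a monomial being a finitely supported map from variables to exponents.
\<close>

type_synonym 'v cpoly = "('v \<Rightarrow>\<^sub>0 nat) \<Rightarrow>\<^sub>0 complex"

definition polys_in :: "'v set \<Rightarrow> 'v cpoly set" where
  "polys_in I = {p. \<forall>m \<in> Poly_Mapping.keys p. Poly_Mapping.keys m \<subseteq> I}"

definition poly_eval :: "'v cpoly \<Rightarrow> ('v \<Rightarrow> complex) \<Rightarrow> complex" where
  "poly_eval p x =
     (\<Sum>m \<in> Poly_Mapping.keys p.
        Poly_Mapping.lookup p m *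
        (\<Prod>v \<in> Poly_Mapping.keys m. x v ^ Poly_Mapping.lookup m v))"

text \<open>
  In the formal partial derivative, the exponent subtraction truncates only if the variable
  does not occur in the monomial, and then the coefficient is zero.
\<close>

definition partial_deriv :: "'v \<Rightarrow> 'v cpoly \<Rightarrow> 'v cpoly" where
  "partial_deriv v p =
     (\<Sum>m \<in> Poly_Mapping.keys p.
        Poly_Mapping.single (m - Poly_Mapping.single v 1)
          (of_nat (Poly_Mapping.lookup m v) * Poly_Mapping.lookup p m))"


text \<open>
  The affine space with coordinates indexed by a finite set \<open>I\<close>. Its points are functions
  that are \<open>undefined\<close> outside \<open>I\<close>, so that distinct functions are distinct points.
\<close>

definition affine_space :: "'v set \<Rightarrow> ('v \<Rightarrow> complex) set" where
  "affine_space I = (I \<rightarrow>\<^sub>E UNIV)"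

definition zariski_closed :: "'v set \<Rightarrow> ('v \<Rightarrow> complex) set \<Rightarrow> bool" where
  "zariski_closed I Z \<longleftrightarrow>
     (\<exists>S \<subseteq> polys_in I. Z = {x \<in> affine_space I. \<forall>p \<in> S. poly_eval p x = 0})"

definition irreducible_closed :: "'v set \<Rightarrow> ('v \<Rightarrow> complex) set \<Rightarrow> bool" where
  "irreducible_closed I Y \<longleftrightarrow>
     zariski_closed I Y \<and> Y \<noteq> {} \<and>
     (\<forall>A B. zariski_closed I A \<and> zariski_closed I B \<and> Y = A \<union> B \<longrightarrow> Y = A \<or> Y = B)"

text \<open>
  The dimension of a Zariski closed set \<open>Z\<close> is the supremum of the lengths \<open>k\<close> of chains
  \<open>Y 0 \<subset> \<dots> \<subset> Y k\<close> of irreducible closed subsets of \<open>Z\<close>. As \<open>Sup {} = 0\<close> for extended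
  natural numbers, these definitions are meant for nonempty \<open>Z\<close> only; the sets to which they
  are applied below are cones containing the origin (for tensors of order at least two).
\<close>

definition zariski_dim :: "'v set \<Rightarrow> ('v \<Rightarrow> complex) set \<Rightarrow> enat" where
  "zariski_dim I Z =
     Sup {enat k | k. \<exists>Y. (\<forall>i \<le> k. irreducible_closed I (Y i) \<and> Y i \<subseteq> Z) \<and>
                          (\<forall>i < k. Y i \<subset> Y (Suc i))}"

definition zariski_codim :: "'v set \<Rightarrow> ('v \<Rightarrow> complex) set \<Rightarrow> enat" where
  "zariski_codim I Z = enat (card I) - zariski_dim I Z"


text \<open>
  A tensor of order \<open>d\<close> on the space of dimension \<open>n + 1\<close> is given by its coordinates
  \<open>T [i\<^sub>1, \<dots>, i\<^sub>d]\<close> with respect to the canonical basis; the values of \<open>T\<close> at lists outside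
  \<open>multi_indices n d\<close> are irrelevant. The \<open>d\<close> factors are numbered from 0 to \<open>d - 1\<close>.
\<close>

definition multi_indices :: "nat \<Rightarrow> nat \<Rightarrow> nat list set" where
  "multi_indices n d = {is. length is = d \<and> set is \<subseteq> {..n}}"

definition symmetric_tensor :: "nat \<Rightarrow> nat \<Rightarrow> (nat list \<Rightarrow> complex) \<Rightarrow> bool" where
  "symmetric_tensor n d T \<longleftrightarrow>
     (\<forall>\<pi> is. \<pi> permutes {..<d} \<and> is \<in> multi_indices n d \<longrightarrow>
        T (map (\<lambda>k. is ! \<pi> k) [0..<d]) = T is)"

definition tensor_poly :: "nat \<Rightarrow> nat \<Rightarrow> (nat list \<Rightarrow> complex) \<Rightarrow> nat cpoly" where
  "tensor_poly n d T =
     (\<Sum>is \<in> multi_indices n d.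
        Poly_Mapping.single (\<Sum>i\<leftarrow>is. Poly_Mapping.single i 1) (T is))"

definition sgr :: "nat \<Rightarrow> nat \<Rightarrow> (nat list \<Rightarrow> complex) \<Rightarrow> enat" where
  "sgr n d T =
     zariski_codim {..n}
       {x \<in> affine_space {..n}.
          \<forall>i \<le> n. poly_eval (partial_deriv i (tensor_poly n d T)) x = 0}"

definition multilinear_form ::
    "nat \<Rightarrow> nat \<Rightarrow> (nat list \<Rightarrow> complex) \<Rightarrow> (nat \<Rightarrow> nat \<Rightarrow> complex) \<Rightarrow> complex" where
  "multilinear_form n d T xs =
     (\<Sum>is \<in> multi_indices n d. T is * (\<Prod>k<d. xs k (is ! k)))"

text \<open>
  A point \<open>x\<close> of the \<open>(d - 1)\<close>-fold product has the coordinates \<open>x (k, i)\<close>, where \<open>k < d - 1\<close>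
  numbers the vectors and \<open>i \<le> n\<close> their entries.
\<close>

definition geometric_rank :: "nat \<Rightarrow> nat \<Rightarrow> (nat list \<Rightarrow> complex) \<Rightarrow> enat" where
  "geometric_rank n d T =
     zariski_codim ({..<d - 1} \<times> {..n})
       {x \<in> affine_space ({..<d - 1} \<times> {..n}).
          \<forall>y \<in> affine_space {..n}. multilinear_form n d T ((curry x)(d - 1 := y)) = 0}"

end

theory Submission
  imports Defs "HOL-Library.Function_Algebras"
    "HOL-Computational_Algebra.Fundamental_Theorem_Algebra"
begin

text \<open>
  Let \<open>X\<close> be the locus of all \<open>(x\<^sub>1, \<dots>, x\<^sub>d\<^sub>-\<^sub>1)\<close> with \<open>T (x\<^sub>1, \<dots>, x\<^sub>d\<^sub>-\<^sub>1, y) = 0\<close> for all \<open>y\<close>, whose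
  codimension is the geometric rank. As \<open>T\<close> is symmetric, the partial derivative of its polynomial
  in direction \<open>i\<close> at \<open>x\<close> is \<open>d\<close> times \<open>T (x, \<dots>, x, e\<^sub>i)\<close>. So the locus \<open>Z\<close>, whose codimension
  is the symmetric geometric rank, is the part of \<open>X\<close> on the diagonal. The diagonal is the zero set
  of \<open>(d - 2) (n + 1)\<close> linear forms, and this is also the difference of the dimensions of the two
  ambient spaces. The theorem follows because \<open>X\<close> is a cone and because intersecting a closed
  cone with the zero set of a linear form lowers its dimension by at most one.

  Dimension being defined by chains of irreducible closed sets, this last fact needs a proof. It
  comes from a second description of the dimension of a closed cone: the least number of linear
  forms whose only common zero on the cone is the origin. For this number the fact is obvious,
  since cutting forms for the part of the cone where \<open>l\<close> vanishes become cutting forms for the cone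
  when \<open>l\<close> is added. Two theorems compare the descriptions.

  If the cone contains a chain of length \<open>k\<close>, then fewer than \<open>k\<close> linear forms do not cut it down
  to the origin (\<open>chain_length_le_cutting_forms\<close>). For each step of the chain choose a function
  that vanishes on the smaller set and not on the larger one. These \<open>k\<close> functions are
  algebraically independent on the cone (\<open>chain_algebraically_independent\<close>), so polynomial
  functions on the cone of degree at most \<open>m\<close> form a space of dimension at least of order
  \<open>m ^ k\<close>. On the other hand, if \<open>r\<close> linear forms cut the cone down to the origin, then by the
  projective Nullstellensatz the functions on the cone form a finitely generated module over the
  polynomials in these forms (\<open>cone_functions_spanned\<close>), and the dimension is at most of order
  \<open>m ^ r\<close>.

  Conversely, if no \<open>s\<close> linear forms cut the cone down to the origin, then it contains a chain of
  length \<open>s + 1\<close> (\<open>chain_of_uncuttable_cone\<close>): cut successively by linear forms that vanish on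
  none of the finitely many irreducible components. That there are finitely many follows from the
  descending chain condition for closed sets.
\<close>

section \<open>Polynomial functions as spans of words\<close>

text \<open>
  The pointwise operations make functions into a commutative algebra; \<open>fscale\<close> supplies the scalar
  multiplication, so that spans and linear independence are available for functions.
\<close>

definition fscale :: "complex \<Rightarrow> ('a \<Rightarrow> complex) \<Rightarrow> 'a \<Rightarrow> complex" where
  "fscale c f = (\<lambda>x. c * f x)"

lemma fscale_apply: "fscale c f x = c * f x"
  by (simp add: fscale_def)

interpretation fs: vector_space fscale
  by unfold_locales (auto simp: fun_eq_iff fscale_apply algebra_simps)

lemma sum_fun_apply: "sum f A x = (\<Sum>a\<in>A. f a x)"
  for f :: "'b \<Rightarrow> 'a \<Rightarrow> complex"
  by (induction A rule: infinite_finite_induct) auto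

lemma prod_fun_apply: "prod f A x = (\<Prod>a\<in>A. f a x)"
  for f :: "'b \<Rightarrow> 'a \<Rightarrow> complex"
  by (induction A rule: infinite_finite_induct) auto

lemma power_fun_apply: "(f ^ k) x = f x ^ k"
  for f :: "'a \<Rightarrow> complex"
  by (induction k) auto

lemmas pointwise = fun_eq_iff fscale_apply power_fun_apply minus_apply
  plus_fun_apply zero_fun_apply times_fun_apply one_fun_apply

text \<open>
  As default simplification rules the pointwise equations also rewrite functions that are not
  applied to an argument, which destroys equations between functions. They are therefore used
  only on request.
\<close>

declare plus_fun_apply [simp del] zero_fun_apply [simp del] times_fun_apply [simp del]
  one_fun_apply [simp del] minus_apply [simp del]

lemma span_mult:
  assumes "f \<in> fs.span A" "g \<in> fs.span B"
    and "\<And>a b. a \<in> A \<Longrightarrow> b \<in> B \<Longrightarrow> a * b \<in> fs.span C"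
  shows "f * g \<in> fs.span C"
proof -
  have *: "a * g \<in> fs.span C" if "a \<in> A" for a
    using assms(2)
  proof (induction rule: fs.span_induct_alt)
    case base
    have "a * 0 = 0" by (simp add: pointwise)
    then show ?case by (simp add: fs.span_zero)
  next
    case (step c x y)
    have "a * (fscale c x + y) = fscale c (a * x) + a * y"
      by (simp add: pointwise algebra_simps)
    then show ?case
      using step assms(3)[OF that] by (simp add: fs.span_add fs.span_scale)
  qed
  show ?thesis
    using assms(1)
  proof (induction rule: fs.span_induct_alt)
    case base
    have "0 * g = 0" by (simp add: pointwise)
    then show ?case by (simp add: fs.span_zero)
  next
    case (step c x y)
    have "(fscale c x + y) * g = fscale c (x * g) + y * g"
      by (simp add: pointwise algebra_simps)
    then show ?case
      using step * by (simp add: fs.span_add fs.span_scale)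
  qed
qed

text \<open>
  The exchange lemma for families. A repetition in the family gives a relation as well.
\<close>

lemma span_linear_relation:
  assumes "finite B" "finite J" "card B < card J" "\<And>j. j \<in> J \<Longrightarrow> h j \<in> fs.span B"
  obtains c where "\<exists>j\<in>J. c j \<noteq> 0" "(\<Sum>j\<in>J. fscale (c j) (h j)) = 0"
proof (cases "inj_on h J")
  case True
  have "fs.dependent (h ` J)"
  proof (rule ccontr)
    assume "\<not> fs.dependent (h ` J)"
    moreover have "h ` J \<subseteq> fs.span B" using assms(4) by auto
    ultimately have "card (h ` J) \<le> card B"
      using fs.independent_span_bound[OF assms(1)] by blast
    then show False using assms(3) True by (simp add: card_image)
  qed
  then obtain u where u: "\<exists>v\<in>h ` J. u v \<noteq> 0" "(\<Sum>v\<in>h ` J. fscale (u v) v) = 0"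
    using fs.dependent_finite[of "h ` J"] assms(2) by auto
  show ?thesis
    by (rule that[of "u \<circ> h"]) (use u True in \<open>auto simp: sum.reindex\<close>)
next
  case False
  then obtain i j where ij: "i \<in> J" "j \<in> J" "h i = h j" "i \<noteq> j"
    by (auto simp: inj_on_def)
  define c where "c k = (if k = i then 1 else if k = j then -1 else (0::complex))" for k
  have "(\<Sum>k\<in>J. fscale (c k) (h k)) = (\<Sum>k\<in>{i,j}. fscale (c k) (h k))"
    by (rule sum.mono_neutral_right) (use ij assms(2) in \<open>auto simp: c_def pointwise\<close>)
  also have "\<dots> = 0" using ij by (auto simp: c_def pointwise)
  finally show ?thesis by (intro that[of c]) (use ij in \<open>auto simp: c_def\<close>)
qed

text \<open>
  A monomial is written as a word in the variables. Splitting a monomial of degree \<open>a + b\<close> into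
  factors of degrees \<open>a\<close> and \<open>b\<close> is then splitting a list, and a multi-index of a tensor
  is already a word. Distinct words may give the same monomial, which is harmless for spans.
\<close>

definition word_fun :: "'v list \<Rightarrow> ('v \<Rightarrow> complex) \<Rightarrow> complex" where
  "word_fun vs x = prod_list (map x vs)"

lemma word_fun_append: "word_fun (us @ vs) = word_fun us * word_fun vs"
  by (auto simp: word_fun_def pointwise)

lemma word_fun_Nil [simp]: "word_fun [] = 1"
  by (auto simp: word_fun_def pointwise)

definition forms :: "'v set \<Rightarrow> nat \<Rightarrow> (('v \<Rightarrow> complex) \<Rightarrow> complex) set" where
  "forms I m = fs.span {word_fun vs | vs. set vs \<subseteq> I \<and> length vs = m}"

definition polyfuns_le :: "'v set \<Rightarrow> nat \<Rightarrow> (('v \<Rightarrow> complex) \<Rightarrow> complex) set" where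
  "polyfuns_le I m = fs.span {word_fun vs | vs. set vs \<subseteq> I \<and> length vs \<le> m}"

definition polyfuns :: "'v set \<Rightarrow> (('v \<Rightarrow> complex) \<Rightarrow> complex) set" where
  "polyfuns I = fs.span {word_fun vs | vs. set vs \<subseteq> I}"

lemma word_fun_in_forms: "set vs \<subseteq> I \<Longrightarrow> word_fun vs \<in> forms I (length vs)"
  unfolding forms_def by (rule fs.span_base) auto

lemma coord_in_forms: "v \<in> I \<Longrightarrow> (\<lambda>x. x v) \<in> forms I 1"
  using word_fun_in_forms[of "[v]" I] by (simp add: word_fun_def [abs_def])

lemma one_in_forms: "1 \<in> forms I 0"
  using word_fun_in_forms[of "[]" I] by simp

lemma subspace_forms: "fs.subspace (forms I m)"
  by (simp add: forms_def)

lemma subspace_polyfuns: "fs.subspace (polyfuns I)"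
  by (simp add: polyfuns_def)

lemma subspace_polyfuns_le: "fs.subspace (polyfuns_le I m)"
  by (simp add: polyfuns_le_def)

lemma forms_mult: "f \<in> forms I a \<Longrightarrow> g \<in> forms I b \<Longrightarrow> f * g \<in> forms I (a + b)"
  unfolding forms_def
  by (erule (1) span_mult) (force simp flip: word_fun_append intro!: fs.span_base)

lemma polyfuns_le_mult:
  "f \<in> polyfuns_le I a \<Longrightarrow> g \<in> polyfuns_le I b \<Longrightarrow> f * g \<in> polyfuns_le I (a + b)"
  unfolding polyfuns_le_def
  by (erule (1) span_mult) (force simp flip: word_fun_append intro!: fs.span_base)

lemma polyfuns_mult: "f \<in> polyfuns I \<Longrightarrow> g \<in> polyfuns I \<Longrightarrow> f * g \<in> polyfuns I"
  unfolding polyfuns_def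
  by (erule (1) span_mult) (force simp flip: word_fun_append intro!: fs.span_base)

lemma polyfuns_le_mono: "a \<le> b \<Longrightarrow> polyfuns_le I a \<subseteq> polyfuns_le I b"
  unfolding polyfuns_le_def by (rule fs.span_mono) auto

lemma forms_subset_polyfuns_le: "forms I m \<subseteq> polyfuns_le I m"
  unfolding polyfuns_le_def forms_def by (rule fs.span_mono) auto

lemma polyfuns_le_subset: "polyfuns_le I m \<subseteq> polyfuns I"
  unfolding polyfuns_le_def polyfuns_def by (rule fs.span_mono) auto

lemma forms_subset_polyfuns: "forms I m \<subseteq> polyfuns I"
  using forms_subset_polyfuns_le polyfuns_le_subset by blast

lemma const_in_polyfuns: "(\<lambda>_. c) \<in> polyfuns I"
proof -
  have "fscale c 1 \<in> polyfuns I"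
    using one_in_forms[of I] forms_subset_polyfuns[of I 0] subspace_polyfuns
    by (intro fs.subspace_scale) auto
  then show ?thesis by (simp add: fscale_def one_fun_apply)
qed

lemma power_in_polyfuns: "f \<in> polyfuns I \<Longrightarrow> f ^ k \<in> polyfuns I"
proof (induction k)
  case 0
  show ?case using const_in_polyfuns[of 1 I] by (simp add: one_fun_def)
next
  case (Suc k)
  then show ?case by (simp add: polyfuns_mult)
qed

lemma power_in_polyfuns_le: "f \<in> polyfuns_le I D \<Longrightarrow> f ^ k \<in> polyfuns_le I (k * D)"
proof (induction k)
  case 0
  show ?case using one_in_forms[of I] forms_subset_polyfuns_le[of I 0] by auto
next
  case (Suc k)
  then show ?case using polyfuns_le_mult[of f I D "f ^ k" "k * D"] by simp
qed

lemma polyfuns_degree_bound: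
  assumes "f \<in> polyfuns I" obtains m where "f \<in> polyfuns_le I m"
proof -
  have "\<exists>m. f \<in> polyfuns_le I m"
    using assms unfolding polyfuns_def
  proof (induction rule: fs.span_induct_alt)
    case base
    show ?case by (auto intro: fs.subspace_0 subspace_polyfuns_le)
  next
    case (step c x y)
    then obtain m vs where m: "y \<in> polyfuns_le I m" "x = word_fun vs" "set vs \<subseteq> I" by auto
    have "y \<in> polyfuns_le I (max m (length vs))"
      using polyfuns_le_mono[of m "max m (length vs)" I] m by auto
    moreover have "x \<in> polyfuns_le I (max m (length vs))"
      using m unfolding polyfuns_le_def by (intro fs.span_base) auto
    ultimately show ?case
      by (meson fs.subspace_add fs.subspace_scale subspace_polyfuns_le)
  qed
  then show ?thesis using that by blast
qed

lemma polyfuns_cong: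
  assumes "f \<in> polyfuns I" "\<And>v. v \<in> I \<Longrightarrow> x v = y v" shows "f x = f y"
  using assms(1) unfolding polyfuns_def
proof (induction rule: fs.span_induct_alt)
  case (step c g h)
  then obtain vs where vs: "g = word_fun vs" "set vs \<subseteq> I" by auto
  have "map x vs = map y vs" using vs assms(2) by (auto simp: map_eq_conv)
  then have "g x = g y" unfolding vs(1) word_fun_def by (rule arg_cong)
  then show ?case using step by (simp add: pointwise)
qed (simp add: pointwise)

lemma forms_homogeneous:
  assumes "f \<in> forms I m" shows "f (\<lambda>v. t * x v) = t ^ m * f x"
  using assms unfolding forms_def
proof (induction rule: fs.span_induct_alt)
  case (step c g h)
  then obtain vs where vs: "g = word_fun vs" "length vs = m" by auto
  have "prod_list (map (\<lambda>v. t * x v) vs) = t ^ length vs * prod_list (map x vs)"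
    by (induction vs) auto
  then show ?case using step vs by (simp add: word_fun_def pointwise algebra_simps)
qed (simp add: pointwise)

text \<open>
  Polynomial functions have a homogeneous decomposition. Its uniqueness, in the form needed for
  cones, is \<open>graded_part_vanishes\<close>: along a line through the origin the homogeneous parts
  become the coefficients of a polynomial in one variable.
\<close>

lemma polyfuns_graded:
  assumes "f \<in> polyfuns I"
  obtains D h where "\<forall>m. h m \<in> forms I m" "f = (\<Sum>m\<le>D. h m)"
proof -
  have "\<exists>D h. (\<forall>m. h m \<in> forms I m) \<and> (\<forall>m>D. h m = 0) \<and> f = (\<Sum>m\<le>D. h m)"
    using assms unfolding polyfuns_def
  proof (induction rule: fs.span_induct_alt)
    case base
    show ?case
      by (rule exI[of _ 0], rule exI[of _ "\<lambda>_. 0"]) (auto intro: fs.subspace_0 subspace_forms)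
  next
    case (step c x y)
    then obtain D h vs where h: "\<And>m. h m \<in> forms I m" "\<And>m. m > D \<Longrightarrow> h m = 0"
      "y = (\<Sum>m\<le>D. h m)" and vs: "x = word_fun vs" "set vs \<subseteq> I" by auto
    let ?n = "length vs"
    define h' where "h' m = (if m = ?n then fscale c x else 0) + h m" for m
    have 1: "h' m \<in> forms I m" for m
      using h(1)[of m] word_fun_in_forms[OF vs(2)] vs(1)
      by (auto simp: h'_def intro!: fs.subspace_add[OF subspace_forms] fs.subspace_scale[OF subspace_forms])
    have "(\<Sum>m\<le>max D ?n. h' m) = fscale c x + (\<Sum>m\<le>max D ?n. h m)"
      by (simp add: h'_def sum.distrib sum.delta)
    also have "(\<Sum>m\<le>max D ?n. h m) = y"
      unfolding h(3) by (rule sum.mono_neutral_right) (auto simp: h(2))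
    finally have "fscale c x + y = (\<Sum>m\<le>max D ?n. h' m)" by simp
    moreover have "\<forall>m>max D ?n. h' m = 0" by (simp add: h'_def h(2))
    ultimately show ?case using 1 by blast
  qed
  then show ?thesis using that by blast
qed

lemma polyfuns_along_line:
  assumes "f \<in> polyfuns I"
  obtains p where "\<forall>t. f (\<lambda>v. t * x v) = poly p t"
proof -
  obtain D h where h: "\<forall>m. h m \<in> forms I m" "f = (\<Sum>m\<le>D. h m)"
    by (rule polyfuns_graded[OF assms])
  have "f (\<lambda>v. t * x v) = poly (\<Sum>m\<le>D. monom (h m x) m) t" for t
    by (simp add: h(2) sum_fun_apply forms_homogeneous[OF h(1)[rule_format]] poly_sum poly_monom mult.commute)
  then show ?thesis using that by blast
qed

lemma graded_part_vanishes:
  assumes h: "\<forall>m. h m \<in> forms I m" and "\<forall>t. (\<Sum>m\<le>D. h m) (\<lambda>v. t * x v) = 0" "m \<le> D"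
  shows "h m x = 0"
proof -
  let ?p = "\<Sum>m\<le>D. monom (h m x) m"
  have "poly ?p t = 0" for t
    using assms(2)[rule_format, of t]
    by (simp add: sum_fun_apply forms_homogeneous[OF h[rule_format]] poly_sum poly_monom mult.commute)
  then have "?p = 0" by (intro poly_all_0_iff_0[THEN iffD1]) simp
  then have "coeff ?p m = 0" by simp
  then show ?thesis using assms(3) by (simp add: coeff_sum sum.delta)
qed

lemma linear_form_compose:
  assumes "f \<in> forms I 1" "\<And>v. v \<in> I \<Longrightarrow> (\<lambda>y. g y v) \<in> forms J 1"
  shows "(\<lambda>y. f (g y)) \<in> forms J 1"
  using assms(1) unfolding forms_def[of I]
proof (induction rule: fs.span_induct_alt)
  case base
  show ?case using fs.subspace_0[OF subspace_forms[of J 1]] by (simp add: zero_fun_def)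
next
  case (step c a b)
  then obtain v where v: "a = word_fun [v]" "v \<in> I" 
    by (auto simp: length_Suc_conv)
  have "(\<lambda>y. (fscale c a + b) (g y)) = fscale c (\<lambda>y. g y v) + (\<lambda>y. b (g y))"
    by (auto simp: pointwise v word_fun_def)
  then show ?case
    using step assms(2)[OF v(2)]
    by (auto intro!: fs.subspace_add[OF subspace_forms] fs.subspace_scale[OF subspace_forms])
qed

lemma finite_words: "finite I \<Longrightarrow> finite {word_fun vs | vs. set vs \<subseteq> I \<and> length vs = m}"
  using finite_lists_length_eq[of I m]
  by (simp add: setcompr_eq_image)

lemma finite_words_le: "finite I \<Longrightarrow> finite {word_fun vs | vs. set vs \<subseteq> I \<and> length vs \<le> m}"
  using finite_lists_length_le[of I m]
  by (simp add: setcompr_eq_image)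

section \<open>The projective Nullstellensatz\<close>

text \<open>
  A graded ideal is recorded as a set of pairs of a degree and a form of that degree. Carrying the
  degree along makes it unambiguous for the zero function.
\<close>

definition graded_ideal :: "'v set \<Rightarrow> (nat \<times> (('v \<Rightarrow> complex) \<Rightarrow> complex)) set \<Rightarrow> bool" where
  "graded_ideal I G \<longleftrightarrow>
     (\<forall>m f. (m, f) \<in> G \<longrightarrow> f \<in> forms I m) \<and>
     (\<forall>m. (m, 0) \<in> G) \<and>
     (\<forall>m f g. (m, f) \<in> G \<and> (m, g) \<in> G \<longrightarrow> (m, f + g) \<in> G) \<and>
     (\<forall>m l f g. (m, f) \<in> G \<and> g \<in> forms I l \<longrightarrow> (l + m, g * f) \<in> G)"

text \<open>
  The ideals without this property contain a power of the irrelevant ideal; they are the ones for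
  which the Nullstellensatz predicts no zero other than the origin.
\<close>

definition misses_all_degrees :: "'v set \<Rightarrow> (nat \<times> (('v \<Rightarrow> complex) \<Rightarrow> complex)) set \<Rightarrow> bool" where
  "misses_all_degrees I G \<longleftrightarrow> (\<forall>M. \<exists>f \<in> forms I M. (M, f) \<notin> G)"

lemma graded_idealD:
  assumes "graded_ideal I G"
  shows "(m, f) \<in> G \<Longrightarrow> f \<in> forms I m" "(m, 0) \<in> G"
    "(m, f) \<in> G \<Longrightarrow> (m, g) \<in> G \<Longrightarrow> (m, f + g) \<in> G"
    "(m, f) \<in> G \<Longrightarrow> g \<in> forms I l \<Longrightarrow> (l + m, g * f) \<in> G"
  using assms unfolding graded_ideal_def by blast+

lemma graded_ideal_scale:
  assumes "graded_ideal I G" "(m, f) \<in> G" shows "(m, fscale c f) \<in> G"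
proof -
  have "(0 + m, fscale c 1 * f) \<in> G"
    by (intro graded_idealD(4)[OF assms] fs.subspace_scale[OF subspace_forms] one_in_forms)
  moreover have "fscale c 1 * f = fscale c f" by (simp add: pointwise)
  ultimately show ?thesis by simp
qed

lemma graded_ideal_subspace: "graded_ideal I G \<Longrightarrow> fs.subspace {f. (m, f) \<in> G}"
  by (auto intro!: fs.subspaceI graded_idealD graded_ideal_scale)

lemma graded_ideal_diff:
  assumes "graded_ideal I G" "(m, f) \<in> G" "(m, g) \<in> G" shows "(m, f - g) \<in> G"
  using fs.subspace_diff[OF graded_ideal_subspace[OF assms(1)], of f m g] assms by simp

lemma forms_subsetI:
  assumes "fs.subspace S" "\<And>vs. set vs \<subseteq> I \<Longrightarrow> length vs = m \<Longrightarrow> word_fun vs \<in> S"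
  shows "forms I m \<subseteq> S"
  unfolding forms_def by (rule fs.span_minimal) (use assms in auto)

text \<open>
  There are only finitely many words of length \<open>M\<close>, so if a union of a chain of ideals contains
  all forms of degree \<open>M\<close>, then already one member does. This is what makes Zorn's lemma
  applicable.
\<close>

lemma misses_all_degrees_chain:
  assumes "finite I" "C \<noteq> {}" "subset.chain \<A> C"
    and C: "\<And>G. G \<in> C \<Longrightarrow> graded_ideal I G \<and> misses_all_degrees I G"
  shows "graded_ideal I (\<Union>C) \<and> misses_all_degrees I (\<Union>C)"
proof
  have chain: "X \<subseteq> Y \<or> Y \<subseteq> X" if "X \<in> C" "Y \<in> C" for X Y
    using assms(3) that by (auto simp: subset.chain_def)
  show "graded_ideal I (\<Union>C)"
    unfolding graded_ideal_def
  proof (intro conjI allI impI)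
    fix m f assume "(m, f) \<in> \<Union>C"
    then show "f \<in> forms I m" using C graded_idealD(1) by blast
  next
    fix m show "(m, 0) \<in> \<Union>C" using C assms(2) graded_idealD(2) by blast
  next
    fix m f g assume "(m, f) \<in> \<Union>C \<and> (m, g) \<in> \<Union>C"
    then obtain X Y where "X \<in> C" "Y \<in> C" "(m, f) \<in> X" "(m, g) \<in> Y" by blast
    then obtain Z where "Z \<in> C" "(m, f) \<in> Z" "(m, g) \<in> Z" using chain by blast
    then show "(m, f + g) \<in> \<Union>C" using C graded_idealD(3) by blast
  next
    fix m l f g assume "(m, f) \<in> \<Union>C \<and> g \<in> forms I l"
    then show "(l + m, g * f) \<in> \<Union>C" using C graded_idealD(4) by blast
  qed
  show "misses_all_degrees I (\<Union>C)"
    unfolding misses_all_degrees_def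
  proof (rule allI, rule ccontr)
    fix M assume *: "\<not> (\<exists>f\<in>forms I M. (M, f) \<notin> \<Union>C)"
    let ?W = "Pair M ` {word_fun vs | vs. set vs \<subseteq> I \<and> length vs = M}"
    have "?W \<subseteq> \<Union>C" using * word_fun_in_forms[of _ I] by blast
    moreover have "finite ?W" using finite_words[OF assms(1)] by blast
    ultimately obtain G where G: "G \<in> C" "?W \<subseteq> G"
      using finite_subset_Union_chain[OF _ _ assms(2,3)] by blast
    have "forms I M \<subseteq> {f. (M, f) \<in> G}"
      by (rule forms_subsetI) (use G C graded_ideal_subspace in blast)+
    then show False using C[OF G(1)] by (auto simp: misses_all_degrees_def)
  qed
qed

text \<open>
  The graded ideal generated by \<open>G\<close> and a form \<open>a\<close> of degree \<open>i\<close>. In degrees below \<open>i\<close> the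
  cofactor of \<open>a\<close> has to be zero.
\<close>

definition adjoin_form ::
    "'v set \<Rightarrow> (nat \<times> (('v \<Rightarrow> complex) \<Rightarrow> complex)) set \<Rightarrow> nat \<Rightarrow> (('v \<Rightarrow> complex) \<Rightarrow> complex)
      \<Rightarrow> (nat \<times> (('v \<Rightarrow> complex) \<Rightarrow> complex)) set" where
  "adjoin_form I G i a =
     {(m, g + h * a) | m g h. (m, g) \<in> G \<and> h \<in> (if i \<le> m then forms I (m - i) else {0})}"

lemma adjoin_formE:
  assumes "(m, f) \<in> adjoin_form I G i a"
  obtains g h where "f = g + h * a" "(m, g) \<in> G"
    "h \<in> (if i \<le> m then forms I (m - i) else {0})"
  using assms unfolding adjoin_form_def by blast

lemma graded_ideal_adjoin_form:
  assumes G: "graded_ideal I G" and a: "a \<in> forms I i"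
  shows "graded_ideal I (adjoin_form I G i a)"
  unfolding graded_ideal_def
proof (intro conjI allI impI)
  fix m f assume "(m, f) \<in> adjoin_form I G i a"
  then obtain g h where "f = g + h * a" "(m, g) \<in> G"
      "h \<in> (if i \<le> m then forms I (m - i) else {0})"
    by (auto simp: adjoin_form_def)
  moreover from this have "h * a \<in> forms I m"
  proof (cases "i \<le> m")
    case True
    then show ?thesis
      using forms_mult[of h I "m - i" a i] a \<open>h \<in> _\<close> by simp
  next
    case False
    then have "h * a = 0" using \<open>h \<in> _\<close> by (simp add: pointwise)
    then show ?thesis using fs.subspace_0[OF subspace_forms] by simp
  qed
  ultimately show "f \<in> forms I m"
    using graded_idealD(1)[OF G] by (auto intro: fs.subspace_add[OF subspace_forms])
next
  fix m
  have "(0::('a \<Rightarrow> complex) \<Rightarrow> complex) = 0 + 0 * a" by (simp add: pointwise)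
  moreover have "0 \<in> (if i \<le> m then forms I (m - i) else {0})"
    using fs.subspace_0[OF subspace_forms] by auto
  ultimately show "(m, 0) \<in> adjoin_form I G i a"
    using graded_idealD(2)[OF G] unfolding adjoin_form_def by blast
next
  fix m f f' assume "(m, f) \<in> adjoin_form I G i a \<and> (m, f') \<in> adjoin_form I G i a"
  then obtain g h g' h' where *: "f = g + h * a" "(m, g) \<in> G"
      "h \<in> (if i \<le> m then forms I (m - i) else {0})" "f' = g' + h' * a" "(m, g') \<in> G"
      "h' \<in> (if i \<le> m then forms I (m - i) else {0})"
    by (auto simp: adjoin_form_def)
  have "f + f' = (g + g') + (h + h') * a" by (simp add: * pointwise algebra_simps)
  moreover have "h + h' \<in> (if i \<le> m then forms I (m - i) else {0})"
    using * fs.subspace_add[OF subspace_forms] by (auto split: if_splits)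
  ultimately show "(m, f + f') \<in> adjoin_form I G i a"
    using graded_idealD(3)[OF G *(2,5)] unfolding adjoin_form_def by blast
next
  fix m l f k assume "(m, f) \<in> adjoin_form I G i a \<and> k \<in> forms I l"
  then obtain g h where *: "f = g + h * a" "(m, g) \<in> G" "k \<in> forms I l"
      "h \<in> (if i \<le> m then forms I (m - i) else {0})"
    by (auto simp: adjoin_form_def)
  have "k * f = (k * g) + (k * h) * a" by (simp add: * pointwise algebra_simps)
  moreover have "k * h \<in> (if i \<le> l + m then forms I (l + m - i) else {0})"
  proof (cases "i \<le> m")
    case True
    then have "k * h \<in> forms I (l + (m - i))" using * forms_mult[of k I l h "m - i"] by simp
    moreover have "l + (m - i) = l + m - i" using True by simp
    ultimately show ?thesis using True by simp
  next
    case False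
    then have "k * h = 0" using * by (simp add: pointwise)
    then show ?thesis using fs.subspace_0[OF subspace_forms] by auto
  qed
  ultimately show "(l + m, k * f) \<in> adjoin_form I G i a"
    using graded_idealD(4)[OF G *(2,3)] unfolding adjoin_form_def by blast
qed

lemma adjoin_form_superset: "G \<subseteq> adjoin_form I G i a"
proof
  fix x assume "x \<in> G"
  obtain m g where x: "x = (m, g)" by (cases x)
  have "g = g + 0 * a" by (simp add: pointwise)
  moreover have "0 \<in> (if i \<le> m then forms I (m - i) else {0})"
    using fs.subspace_0[OF subspace_forms] by auto
  ultimately show "x \<in> adjoin_form I G i a"
    unfolding adjoin_form_def using \<open>x \<in> G\<close> x by blast
qed

lemma in_adjoin_form: assumes "graded_ideal I G" shows "(i, a) \<in> adjoin_form I G i a"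
proof -
  have "a = 0 + 1 * a" by (simp add: pointwise)
  moreover have "1 \<in> (if i \<le> i then forms I (i - i) else {0})"
    using one_in_forms by auto
  ultimately show ?thesis
    unfolding adjoin_form_def using graded_idealD(2)[OF assms] by blast
qed

definition maximal_graded_ideal :: "'v set \<Rightarrow> (nat \<times> (('v \<Rightarrow> complex) \<Rightarrow> complex)) set \<Rightarrow> bool" where
  "maximal_graded_ideal I G \<longleftrightarrow> graded_ideal I G \<and> misses_all_degrees I G \<and>
     (\<forall>G'. graded_ideal I G' \<and> misses_all_degrees I G' \<and> G \<subseteq> G' \<longrightarrow> G' = G)"

lemma exists_maximal_graded_ideal:
  assumes "finite I" "graded_ideal I G" "misses_all_degrees I G"
  obtains G' where "maximal_graded_ideal I G'" "G \<subseteq> G'"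
proof -
  let ?A = "{G'. (graded_ideal I G' \<and> misses_all_degrees I G') \<and> G \<subseteq> G'}"
  have "\<exists>M\<in>?A. \<forall>X\<in>?A. M \<subseteq> X \<longrightarrow> X = M"
  proof (rule subset_Zorn_nonempty)
    show "?A \<noteq> {}" using assms by auto
  next
    fix C assume C: "C \<noteq> {}" "subset.chain ?A C"
    then have sub: "C \<subseteq> ?A" by (auto simp: subset.chain_def)
    have "graded_ideal I (\<Union>C) \<and> misses_all_degrees I (\<Union>C)"
      by (rule misses_all_degrees_chain[OF assms(1) C]) (use sub in auto)
    moreover obtain G' where "G' \<in> C" using C(1) by blast
    then have "G \<subseteq> \<Union>C" using sub by fast
    ultimately show "\<Union>C \<in> ?A" by simp
  qed
  then obtain M where "M \<in> ?A" "\<forall>X\<in>?A. M \<subseteq> X \<longrightarrow> X = M" ..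
  then have "maximal_graded_ideal I M" "G \<subseteq> M"
    unfolding maximal_graded_ideal_def by (simp_all, metis subset_trans)
  then show ?thesis by (rule that)
qed

lemma maximal_graded_idealD:
  assumes "maximal_graded_ideal I G" shows "graded_ideal I G" "misses_all_degrees I G"
  using assms unfolding maximal_graded_ideal_def
  by (rule conjunct1, rule conjunct2[THEN conjunct1])

lemma maximal_adjoin_all:
  assumes "maximal_graded_ideal I G" "a \<in> forms I i" "(i, a) \<notin> G"
  obtains M where "\<forall>f\<in>forms I M. (M, f) \<in> adjoin_form I G i a"
proof -
  have G: "graded_ideal I G" by (rule maximal_graded_idealD[OF assms(1)])
  have "\<not> misses_all_degrees I (adjoin_form I G i a)"
  proof
    assume "misses_all_degrees I (adjoin_form I G i a)"
    then have "adjoin_form I G i a = G"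
      using assms(1) graded_ideal_adjoin_form[OF G assms(2)] adjoin_form_superset
      unfolding maximal_graded_ideal_def by blast
    then show False using in_adjoin_form[OF G, of i a] assms(3) by simp
  qed
  then show ?thesis using that unfolding misses_all_degrees_def by blast
qed

text \<open>
  If neither \<open>a\<close> nor \<open>b\<close> lies in \<open>G\<close>, then by maximality all forms of some degree \<open>M\<close> lie in
  \<open>G + (a)\<close> and all forms of some degree \<open>N\<close> lie in \<open>G + (b)\<close>. A word of length \<open>M + N\<close> is a
  product of one of each kind, hence lies in \<open>G + (a b) = G\<close>, which is impossible.
\<close>

lemma maximal_graded_ideal_prime:
  assumes max: "maximal_graded_ideal I G" and a: "a \<in> forms I i" and b: "b \<in> forms I j"
    and ab: "(i + j, a * b) \<in> G"
  shows "(i, a) \<in> G \<or> (j, b) \<in> G"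
proof (rule ccontr)
  assume "\<not> ?thesis"
  then have "(i, a) \<notin> G" "(j, b) \<notin> G" by auto
  obtain M where M: "\<forall>f\<in>forms I M. (M, f) \<in> adjoin_form I G i a"
    by (rule maximal_adjoin_all[OF max a \<open>(i, a) \<notin> G\<close>])
  obtain N where N: "\<forall>f\<in>forms I N. (N, f) \<in> adjoin_form I G j b"
    by (rule maximal_adjoin_all[OF max b \<open>(j, b) \<notin> G\<close>])
  have G: "graded_ideal I G" "misses_all_degrees I G"
    by (rule maximal_graded_idealD[OF max])+
  have "forms I (M + N) \<subseteq> {f. (M + N, f) \<in> G}"
  proof (rule forms_subsetI[OF graded_ideal_subspace[OF G(1)]])
    fix vs assume vs: "set vs \<subseteq> I" "length vs = M + N"
    have u: "word_fun (take M vs) \<in> forms I M" 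
      using word_fun_in_forms[of "take M vs" I] vs set_take_subset[of M vs] by simp
    have w: "word_fun (drop M vs) \<in> forms I N"
      using word_fun_in_forms[of "drop M vs" I] vs set_drop_subset[of M vs] by simp
    obtain g h where g: "word_fun (take M vs) = g + h * a" "(M, g) \<in> G"
        "h \<in> (if i \<le> M then forms I (M - i) else {0})"
      using bspec[OF M u] by (rule adjoin_formE)
    obtain g' h' where g': "word_fun (drop M vs) = g' + h' * b" "(N, g') \<in> G"
        "h' \<in> (if j \<le> N then forms I (N - j) else {0})"
      using bspec[OF N w] by (rule adjoin_formE)
    let ?u = "word_fun (take M vs)" and ?w = "word_fun (drop M vs)"
    \<comment> \<open>If one of the degrees is too small, then the cofactor is zero and so is the product.\<close>
    have hh: "(M + N, h * h' * (a * b)) \<in> G"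
    proof (cases "i \<le> M \<and> j \<le> N")
      case True
      then have "h * h' \<in> forms I ((M - i) + (N - j))"
        using g(3) g'(3) forms_mult[of h I "M - i" h' "N - j"] by simp
      moreover have "(M - i) + (N - j) + (i + j) = M + N" using True by simp
      ultimately show ?thesis using graded_idealD(4)[OF G(1) ab, of "h * h'"] by metis
    next
      case False
      then have "h * h' * (a * b) = 0" using g(3) g'(3) by (auto simp: pointwise)
      then show ?thesis using graded_idealD(2)[OF G(1)] by simp
    qed
    have ha: "h * a \<in> forms I M"
      using g u graded_idealD(1)[OF G(1)] fs.subspace_diff[OF subspace_forms, of ?u I M g] by simp
    have "word_fun vs = ?u * ?w" by (simp flip: word_fun_append)
    also have "\<dots> = ?w * g + (h * a * g' + h * h' * (a * b))"
      by (simp only: g(1) g'(1)) (simp add: pointwise algebra_simps)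
    finally have *: "word_fun vs = \<dots>" .
    have "(N + M, ?w * g) \<in> G" by (rule graded_idealD(4)[OF G(1) g(2) w])
    moreover have "(M + N, h * a * g') \<in> G" by (rule graded_idealD(4)[OF G(1) g'(2) ha])
    ultimately show "word_fun vs \<in> {f. (M + N, f) \<in> G}"
      using hh * graded_idealD(3)[OF G(1)] by (simp add: add.commute)
  qed
  then show False using G(2) by (auto simp: misses_all_degrees_def)
qed

lemma one_notin_maximal: 
  assumes "maximal_graded_ideal I G" shows "(0, 1) \<notin> G"
proof
  assume *: "(0, 1) \<in> G"
  have G: "graded_ideal I G" "misses_all_degrees I G"
    by (rule maximal_graded_idealD[OF assms])+
  have "(m, f) \<in> G" if "f \<in> forms I m" for m f
    using graded_idealD(4)[OF G(1) * that] by (simp add: times_fun_def one_fun_def)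
  then show False using G(2) by (auto simp: misses_all_degrees_def)
qed

lemma forms_power: "f \<in> forms I 1 \<Longrightarrow> f ^ k \<in> forms I k"
  using one_in_forms[of I] forms_mult[of f I 1] by (induction k) auto

lemma power_notin_maximal:
  assumes "maximal_graded_ideal I G" "(1, a) \<notin> G" "a \<in> forms I 1" shows "(k, a ^ k) \<notin> G"
proof (induction k)
  case 0 show ?case using one_notin_maximal[OF assms(1)] by simp
next
  case (Suc k)
  then show ?case
    using maximal_graded_ideal_prime[OF assms(1) assms(3) forms_power[OF assms(3), of k]] assms(2)
    by auto
qed

text \<open>
  Modulo \<open>G\<close> every form of high degree is a multiple of a high power of \<open>a\<close>, with a cofactor of
  the fixed degree \<open>M\<close>. The graded pieces of the quotient by \<open>G\<close> therefore have bounded dimension.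
\<close>

lemma maximal_power_complement:
  assumes "maximal_graded_ideal I G" "a \<in> forms I 1" "(1, a) \<notin> G"
  obtains M where "\<forall>j. \<forall>f \<in> forms I (M + j). 
     \<exists>h \<in> forms I M. (M + j, f - h * a ^ j) \<in> G"
proof -
  have G: "graded_ideal I G" by (rule maximal_graded_idealD[OF assms(1)])
  obtain M0 where M0: "\<forall>f\<in>forms I M0. (M0, f) \<in> adjoin_form I G 1 a"
    by (rule maximal_adjoin_all[OF assms])
  have step: "\<exists>h \<in> forms I (M0 + j). (M0 + Suc j, f - h * a) \<in> G" if f: "f \<in> forms I (M0 + Suc j)" for j f
  proof -
    have "forms I (M0 + Suc j) \<subseteq> {f. (M0 + Suc j, f) \<in> adjoin_form I G 1 a}"
    proof (rule forms_subsetI[OF graded_ideal_subspace[OF graded_ideal_adjoin_form[OF G assms(2)]]])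
      fix vs assume vs: "set vs \<subseteq> I" "length vs = M0 + Suc j"
      have u: "word_fun (take (Suc j) vs) \<in> forms I (Suc j)" 
        using word_fun_in_forms[of "take (Suc j) vs" I] vs set_take_subset[of "Suc j" vs] by simp
      have w: "word_fun (drop (Suc j) vs) \<in> forms I M0"
        using word_fun_in_forms[of "drop (Suc j) vs" I] vs set_drop_subset[of "Suc j" vs] by simp
      show "word_fun vs \<in> {f. (M0 + Suc j, f) \<in> adjoin_form I G 1 a}"
        using graded_idealD(4)[OF graded_ideal_adjoin_form[OF G assms(2)] bspec[OF M0 w] u]
        by (simp add: add.commute flip: word_fun_append)
    qed
    then obtain g h where *: "f = g + h * a" "(M0 + Suc j, g) \<in> G" "h \<in> forms I (M0 + j)"
      using f by (auto simp: adjoin_form_def)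
    moreover from this have "f - h * a = g" by simp
    ultimately have "(M0 + Suc j, f - h * a) \<in> G" by (simp only:)
    then show ?thesis using *(3) by blast
  qed
  have "\<exists>h \<in> forms I M0. (M0 + j, f - h * a ^ j) \<in> G" if "f \<in> forms I (M0 + j)" for j f
    using that
  proof (induction j arbitrary: f)
    case 0
    have "f - f * a ^ 0 = 0" by (simp add: pointwise)
    then have "(M0 + 0, f - f * a ^ 0) \<in> G" by (simp only: graded_idealD(2)[OF G])
    then show ?case by (rule bexI[where x = f]) (use 0 in simp)
  next
    case (Suc j)
    obtain h where h: "h \<in> forms I (M0 + j)" "(M0 + Suc j, f - h * a) \<in> G"
      using step[OF Suc.prems] by blast
    obtain k where k: "k \<in> forms I M0" "(M0 + j, h - k * a ^ j) \<in> G"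
      using Suc.IH[OF h(1)] by blast
    have "(1 + (M0 + j), a * (h - k * a ^ j)) \<in> G"
      by (rule graded_idealD(4)[OF G k(2) assms(2)])
    then have "(M0 + Suc j, (f - h * a) + a * (h - k * a ^ j)) \<in> G"
      by (intro graded_idealD(3)[OF G h(2)]) simp
    moreover have "(f - h * a) + a * (h - k * a ^ j) = f - k * a ^ Suc j"
      by (simp add: pointwise algebra_simps)
    ultimately show ?case using k(1) by auto
  qed
  then show ?thesis using that by blast
qed

text \<open>
  The homogenization of \<open>p\<close> to degree \<open>m\<close>, evaluated at the pair \<open>(a, b)\<close>: the polynomial
  \<open>p (b / a)\<close> multiplied by \<open>a ^ m\<close>.
\<close>

definition binary_form ::
    "complex poly \<Rightarrow> nat \<Rightarrow> ('a \<Rightarrow> complex) \<Rightarrow> ('a \<Rightarrow> complex) \<Rightarrow> 'a \<Rightarrow> complex" where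
  "binary_form p m a b = (\<Sum>j\<le>m. fscale (coeff p j) (b ^ j * a ^ (m - j)))"

lemma binary_form_in_forms:
  assumes "a \<in> forms I 1" "b \<in> forms I 1" shows "binary_form p m a b \<in> forms I m"
  unfolding binary_form_def
proof (intro fs.subspace_sum[OF subspace_forms] fs.subspace_scale[OF subspace_forms])
  fix j assume "j \<in> {..m}"
  then show "b ^ j * a ^ (m - j) \<in> forms I m"
    using forms_mult[OF forms_power[OF assms(2), of j] forms_power[OF assms(1), of "m - j"]] by simp
qed

lemma binary_form_root:
  assumes "degree q \<le> m"
  shows "binary_form ([:-c, 1:] * q) (Suc m) a b = (b - fscale c a) * binary_form q m a b"
proof
  fix x
  have "coeff q (Suc m) = 0" using assms by (intro coeff_eq_0) simp
  have "binary_form ([:-c, 1:] * q) (Suc m) a b x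
      = (\<Sum>j\<le>Suc m. (if j = 0 then 0 else coeff q (j - 1)) * (b x ^ j * a x ^ (Suc m - j)))
        - (\<Sum>j\<le>Suc m. c * coeff q j * (b x ^ j * a x ^ (Suc m - j)))"
    unfolding binary_form_def sum_subtractf[symmetric] sum_fun_apply
    by (rule sum.cong) (auto simp: pointwise coeff_pCons algebra_simps split: nat.split)
  also have "(\<Sum>j\<le>Suc m. (if j = 0 then 0 else coeff q (j - 1)) * (b x ^ j * a x ^ (Suc m - j)))
      = (\<Sum>j\<le>m. coeff q j * (b x ^ Suc j * a x ^ (m - j)))"
    by (subst sum.atMost_Suc_shift) simp
  also have "\<dots> = b x * binary_form q m a b x"
    unfolding binary_form_def sum_fun_apply sum_distrib_left
    by (rule sum.cong) (auto simp: pointwise)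
  also have "(\<Sum>j\<le>Suc m. c * coeff q j * (b x ^ j * a x ^ (Suc m - j)))
      = (\<Sum>j\<le>m. c * coeff q j * (b x ^ j * a x ^ (Suc m - j)))"
    using \<open>coeff q (Suc m) = 0\<close> by simp
  also have "\<dots> = c * a x * binary_form q m a b x"
    unfolding binary_form_def sum_fun_apply sum_distrib_left
    by (rule sum.cong) (auto simp: pointwise Suc_diff_le)
  finally show "binary_form ([:-c, 1:] * q) (Suc m) a b x
      = ((b - fscale c a) * binary_form q m a b) x"
    by (simp add: pointwise algebra_simps)
qed

text \<open>
  Over the complex numbers a binary form is a product of linear forms, and one of the factors lies
  in the prime ideal \<open>G\<close>. As \<open>a\<close> does not, it is a factor of the form \<open>b - c a\<close>. The roots of \<open>p\<close>
  are split off one at a time.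
\<close>

lemma maximal_binary_form:
  assumes max: "maximal_graded_ideal I G" and a: "a \<in> forms I 1" "(1, a) \<notin> G"
    and b: "b \<in> forms I 1" and "p \<noteq> 0" "degree p \<le> m" "(m, binary_form p m a b) \<in> G"
  shows "\<exists>c. (1, b - fscale c a) \<in> G"
  using assms(5-)
proof (induction "degree p" arbitrary: p m)
  case 0
  then obtain c where c: "p = [:c:]" "c \<noteq> 0" by (metis degree_eq_zeroE pCons_eq_0_iff)
  have G: "graded_ideal I G" by (rule maximal_graded_idealD[OF max])
  have "binary_form p m a b = (\<Sum>j\<in>{0}. fscale (coeff p j) (b ^ j * a ^ (m - j)))"
    unfolding binary_form_def
    by (rule sum.mono_neutral_right) (auto simp: c pointwise coeff_pCons split: nat.split)
  also have "\<dots> = fscale c (a ^ m)" by (simp add: c pointwise)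
  finally have "(m, fscale (1 / c) (fscale c (a ^ m))) \<in> G"
    using 0 graded_ideal_scale[OF G] by (simp only:)
  moreover have "fscale (1 / c) (fscale c (a ^ m)) = a ^ m" using c by (simp add: pointwise)
  ultimately show ?case using power_notin_maximal[OF max a(2,1)] by simp
next
  case (Suc n)
  then obtain c where "poly p c = 0"
    using fundamental_theorem_of_algebra[of p] by (metis constant_degree nat.distinct(1))
  then obtain q where q: "p = [:-c, 1:] * q" using poly_eq_0_iff_dvd[of p c] by (auto elim: dvdE)
  have "q \<noteq> 0" using q Suc by auto
  then have dq: "degree p = Suc (degree q)" unfolding q by (subst degree_mult_eq) auto
  then obtain m' where m': "m = Suc m'" "degree q \<le> m'" using Suc.prems by (cases m) auto
  have "(1 + m', (b - fscale c a) * binary_form q m' a b) \<in> G"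
    using Suc.prems(3) unfolding q m'(1) binary_form_root[OF m'(2)] by simp
  then consider "(1, b - fscale c a) \<in> G" | "(m', binary_form q m' a b) \<in> G"
    using maximal_graded_ideal_prime[OF max _ binary_form_in_forms[OF a(1) b, of q m'], of "b - fscale c a" 1]
      fs.subspace_diff[OF subspace_forms b fs.subspace_scale[OF subspace_forms a(1)]]
    by blast
  then show ?case
    using Suc.hyps(1)[OF _ \<open>q \<noteq> 0\<close> m'(2)] Suc.hyps(2) dq by cases auto
qed

text \<open>
  Modulo \<open>G\<close>, all linear forms are multiples of one of them. The \<open>m + 1\<close> products of powers of \<open>a\<close>
  and \<open>b\<close> of degree \<open>m\<close> are, modulo \<open>G\<close>, multiples of a power of \<open>a\<close> by forms of the fixed
  degree \<open>M\<close>. For large \<open>m\<close> there are more of them than words of length \<open>M\<close>, so some binary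
  form in \<open>a\<close> and \<open>b\<close> lies in \<open>G\<close>.
\<close>

lemma maximal_linear_proportional:
  assumes fin: "finite I" and max: "maximal_graded_ideal I G"
    and a: "a \<in> forms I 1" "(1, a) \<notin> G" and b: "b \<in> forms I 1"
  obtains c where "(1, b - fscale c a) \<in> G"
proof -
  have G: "graded_ideal I G" by (rule maximal_graded_idealD[OF max])
  obtain M where M: "\<forall>j. \<forall>f \<in> forms I (M + j). \<exists>h \<in> forms I M. (M + j, f - h * a ^ j) \<in> G"
    by (rule maximal_power_complement[OF max a])
  define W where "W = {word_fun vs | vs. set vs \<subseteq> I \<and> length vs = M}"
  have W: "finite W" "forms I M = fs.span W"
    using finite_words[OF fin] by (auto simp: W_def forms_def)
  define C where "C = card W"
  \<comment> \<open>large enough for more products of degree \<open>m\<close> than words of length \<open>M\<close>\<close>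
  define m where "m = M + C"
  have "\<exists>h. h \<in> forms I M \<and> (m, b ^ j * a ^ (m - j) - h * a ^ C) \<in> G" if "j \<le> m" for j
  proof -
    have "b ^ j * a ^ (m - j) \<in> forms I m"
      using forms_mult[OF forms_power[OF b, of j] forms_power[OF a(1), of "m - j"]] that by simp
    with M show ?thesis unfolding m_def by blast
  qed
  then obtain h where h: "\<And>j. j \<le> m \<Longrightarrow> h j \<in> forms I M"
      "\<And>j. j \<le> m \<Longrightarrow> (m, b ^ j * a ^ (m - j) - h j * a ^ C) \<in> G"
    by metis
  obtain c where c: "\<exists>j\<in>{..m}. c j \<noteq> 0" "(\<Sum>j\<in>{..m}. fscale (c j) (h j)) = 0"
    by (rule span_linear_relation[of W "{..m}" h])
      (use W h(1) in \<open>auto simp: m_def C_def\<close>)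
  define p where "p = (\<Sum>j\<le>m. monom (c j) j)"
  have coeff_p: "coeff p j = (if j \<le> m then c j else 0)" for j
    by (auto simp: p_def coeff_sum sum.delta)
  have "p \<noteq> 0" using c(1) coeff_p by (metis atMost_iff coeff_0)
  moreover have "degree p \<le> m" by (intro degree_le) (auto simp: coeff_p)
  moreover have "(m, binary_form p m a b) \<in> G"
  proof -
    have "binary_form p m a b = binary_form p m a b - (\<Sum>j\<le>m. fscale (c j) (h j)) * a ^ C"
      using c(2) by (simp add: pointwise)
    also have "\<dots> = (\<Sum>j\<le>m. fscale (c j) (b ^ j * a ^ (m - j) - h j * a ^ C))"
      by (simp add: binary_form_def coeff_p pointwise sum_fun_apply sum_distrib_left
          algebra_simps sum_subtractf)
    also have "\<dots> \<in> {f. (m, f) \<in> G}"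
      by (intro fs.subspace_sum[OF graded_ideal_subspace[OF G]]
          fs.subspace_scale[OF graded_ideal_subspace[OF G]]) (use h(2) in auto)
    finally show ?thesis by simp
  qed
  ultimately show ?thesis using maximal_binary_form[OF max a b] that by blast
qed

text \<open>
  Enlarge the ideal to a maximal one, and let \<open>a\<close> be a coordinate function outside it. Every
  coordinate function is congruent to a multiple \<open>p u\<close> of \<open>a\<close>. These multiples are the
  coordinates of a point \<open>p\<close>, and a form \<open>f\<close> of degree \<open>m\<close> is congruent to \<open>f p\<close> times
  \<open>a ^ m\<close>. Since no power of \<open>a\<close> lies in the ideal, all its members vanish at \<open>p\<close>.
\<close>

theorem projective_nullstellensatz:
  assumes fin: "finite I" and "graded_ideal I G" "misses_all_degrees I G"
  obtains x v where "v \<in> I" "x v \<noteq> 0" "\<forall>m f. (m, f) \<in> G \<longrightarrow> f x = 0"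
proof -
  obtain G' where max: "maximal_graded_ideal I G'" and sub: "G \<subseteq> G'"
    by (rule exists_maximal_graded_ideal[OF assms])
  have G': "graded_ideal I G'" "misses_all_degrees I G'"
    by (rule maximal_graded_idealD[OF max])+
  have "\<exists>v\<in>I. (1, \<lambda>x. x v) \<notin> G'"
  proof (rule ccontr)
    assume "\<not> ?thesis"
    then have *: "(1, \<lambda>x. x v) \<in> G'" if "v \<in> I" for v using that by blast
    have "forms I 1 \<subseteq> {f. (1, f) \<in> G'}"
    proof (rule forms_subsetI[OF graded_ideal_subspace[OF G'(1)]])
      fix vs :: "'a list" assume "set vs \<subseteq> I" "length vs = 1"
      then obtain v where "vs = [v]" "v \<in> I" by (auto simp: length_Suc_conv)
      then show "word_fun vs \<in> {f. (1, f) \<in> G'}" using *[of v] by (simp add: word_fun_def [abs_def])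
    qed
    then show False using G'(2) by (auto simp: misses_all_degrees_def)
  qed
  then obtain v where v: "v \<in> I" "(1, \<lambda>x. x v) \<notin> G'" by blast
  define a where "a = (\<lambda>x::'a \<Rightarrow> complex. x v)"
  have a: "a \<in> forms I 1" "(1, a) \<notin> G'" using v coord_in_forms by (auto simp: a_def)
  have "\<exists>c. (1, (\<lambda>x. x u) - fscale c a) \<in> G'" if "u \<in> I" for u
    by (rule maximal_linear_proportional[OF fin max a coord_in_forms[OF that]]) blast
  then obtain p where p: "\<And>u. u \<in> I \<Longrightarrow> (1, (\<lambda>x. x u) - fscale (p u) a) \<in> G'" by metis
  \<comment> \<open>If \<open>p v\<close> were not 1, then a nonzero multiple of \<open>a\<close> would lie in the ideal.\<close>
  have "p v = 1"
  proof (rule ccontr)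
    assume "p v \<noteq> 1"
    then have "fscale (1 / (1 - p v)) ((\<lambda>x. x v) - fscale (p v) a) = a"
      by (auto simp: pointwise a_def divide_simps) (simp add: algebra_simps)
    then show False using graded_ideal_scale[OF G'(1) p[OF v(1)], of "1 / (1 - p v)"] a(2) by simp
  qed
  have word: "(length vs, word_fun vs - fscale (word_fun vs p) (a ^ length vs)) \<in> G'"
    if "set vs \<subseteq> I" for vs
    using that
  proof (induction vs)
    case Nil
    have "word_fun [] - fscale (word_fun [] p) (a ^ length ([]::'a list)) = 0"
      by (simp add: pointwise)
    then show ?case using graded_idealD(2)[OF G'(1)] by simp
  next
    case (Cons u vs)
    let ?n = "length vs"
    have 1: "(1 + ?n, (\<lambda>x. x u) * (word_fun vs - fscale (word_fun vs p) (a ^ ?n))) \<in> G'"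
      using Cons by (intro graded_idealD(4)[OF G'(1)] coord_in_forms) auto
    have 2: "(?n + 1, fscale (word_fun vs p) (a ^ ?n) * ((\<lambda>x. x u) - fscale (p u) a)) \<in> G'"
      using Cons p by (intro graded_idealD(4)[OF G'(1)] fs.subspace_scale[OF subspace_forms]
          forms_power a) auto
    have "(\<lambda>x. x u) * (word_fun vs - fscale (word_fun vs p) (a ^ ?n))
        + fscale (word_fun vs p) (a ^ ?n) * ((\<lambda>x. x u) - fscale (p u) a)
        = word_fun (u # vs) - fscale (word_fun (u # vs) p) (a ^ Suc ?n)"
      by (simp add: pointwise word_fun_def algebra_simps)
    then show ?case using graded_idealD(3)[OF G'(1), of "Suc ?n"] 1 2 by fastforce
  qed
  have val: "forms I m \<subseteq> {f. (m, f - fscale (f p) (a ^ m)) \<in> G'}" for m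
  proof (rule forms_subsetI)
    show "fs.subspace {f. (m, f - fscale (f p) (a ^ m)) \<in> G'}"
    proof (rule fs.subspaceI)
      have "(0::('a \<Rightarrow> complex) \<Rightarrow> complex) - fscale (0 p) (a ^ m) = 0" by (simp add: pointwise)
      then show "0 \<in> {f. (m, f - fscale (f p) (a ^ m)) \<in> G'}"
        using graded_idealD(2)[OF G'(1)] by (simp add: zero_fun_apply)
    next
      fix f g assume fg: "f \<in> {f. (m, f - fscale (f p) (a ^ m)) \<in> G'}"
        "g \<in> {f. (m, f - fscale (f p) (a ^ m)) \<in> G'}"
      have "f + g - fscale ((f + g) p) (a ^ m)
          = (f - fscale (f p) (a ^ m)) + (g - fscale (g p) (a ^ m))"
        by (simp add: pointwise algebra_simps)
      then show "f + g \<in> {f. (m, f - fscale (f p) (a ^ m)) \<in> G'}"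
        using fg graded_idealD(3)[OF G'(1)] by (simp only: mem_Collect_eq)
    next
      fix c f assume f: "f \<in> {f. (m, f - fscale (f p) (a ^ m)) \<in> G'}"
      have "fscale c f - fscale (fscale c f p) (a ^ m)
          = fscale c (f - fscale (f p) (a ^ m))"
        by (simp add: pointwise algebra_simps)
      then show "fscale c f \<in> {f. (m, f - fscale (f p) (a ^ m)) \<in> G'}"
        using f graded_ideal_scale[OF G'(1)] by (simp only: mem_Collect_eq)
    qed
  qed (use word in auto)
  have "f p = 0" if "(m, f) \<in> G" for m f
  proof (rule ccontr)
    assume nz: "f p \<noteq> 0"
    have f: "(m, f) \<in> G'" using that sub by blast
    then have "(m, f - fscale (f p) (a ^ m)) \<in> G'" using val graded_idealD(1)[OF G'(1)] by blast
    then have *: "(m, fscale (1 / f p) (f - (f - fscale (f p) (a ^ m)))) \<in> G'"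
      by (rule graded_ideal_scale[OF G'(1) graded_ideal_diff[OF G'(1) f]])
    have **: "fscale (1 / f p) (f - (f - fscale (f p) (a ^ m))) = a ^ m"
      using nz by (simp add: pointwise)
    have "(m, a ^ m) \<in> G'" using * unfolding ** .
    then show False using power_notin_maximal[OF max a(2,1)] by blast
  qed
  then show ?thesis using that[of v p] v \<open>p v = 1\<close> by auto
qed

section \<open>Zariski closed sets as zero sets of polynomial functions\<close>

text \<open>
  The bridge from formal polynomials to polynomial functions: evaluation turns a monomial into a
  product of coordinate functions. Its outcome is \<open>zariski_closed_iff\<close>, which describes closed
  sets without formal polynomials.
\<close>

definition monomial_fun :: "('v \<Rightarrow>\<^sub>0 nat) \<Rightarrow> ('v \<Rightarrow> complex) \<Rightarrow> complex" where
  "monomial_fun m x = (\<Prod>v\<in>Poly_Mapping.keys m. x v ^ Poly_Mapping.lookup m v)"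

lemma monomial_fun_superset:
  assumes "finite K" "Poly_Mapping.keys m \<subseteq> K"
  shows "monomial_fun m x = (\<Prod>v\<in>K. x v ^ Poly_Mapping.lookup m v)"
  unfolding monomial_fun_def
  by (rule prod.mono_neutral_left) (use assms in \<open>auto simp: in_keys_iff\<close>)

lemma monomial_fun_add: "monomial_fun (a + b) x = monomial_fun a x * monomial_fun b x"
proof -
  let ?K = "Poly_Mapping.keys a \<union> Poly_Mapping.keys b"
  have "Poly_Mapping.keys (a + b) \<subseteq> ?K" by (rule Poly_Mapping.keys_add)
  then show ?thesis
    by (subst (1 2 3) monomial_fun_superset[of ?K])
      (auto simp: lookup_add power_add prod.distrib)
qed

lemma monomial_fun_single: "monomial_fun (Poly_Mapping.single v k) x = x v ^ k"
  by (simp add: monomial_fun_superset[of "{v}"])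

lemma monomial_fun_0: "monomial_fun 0 x = 1"
  by (simp add: monomial_fun_def)

lemma monomial_fun_word:
  "monomial_fun (\<Sum>v\<leftarrow>vs. Poly_Mapping.single v 1) x = word_fun vs x"
  by (induction vs) (auto simp: monomial_fun_0 monomial_fun_add monomial_fun_single word_fun_def one_fun_apply)

lemma poly_eval_superset:
  assumes "finite K" "Poly_Mapping.keys p \<subseteq> K"
  shows "poly_eval p x = (\<Sum>m\<in>K. Poly_Mapping.lookup p m * monomial_fun m x)"
  unfolding poly_eval_def monomial_fun_def[symmetric]
  by (rule sum.mono_neutral_left) (use assms in \<open>auto simp: in_keys_iff\<close>)

lemma poly_eval_add: "poly_eval (p + q) x = poly_eval p x + poly_eval q x"
proof -
  let ?K = "Poly_Mapping.keys p \<union> Poly_Mapping.keys q"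
  have "Poly_Mapping.keys (p + q) \<subseteq> ?K" by (rule Poly_Mapping.keys_add)
  then show ?thesis
    by (subst (1 2 3) poly_eval_superset[of ?K])
      (auto simp: lookup_add ring_distribs sum.distrib)
qed

lemma poly_eval_0: "poly_eval 0 x = 0"
  by (simp add: poly_eval_def)

lemma poly_eval_sum: "poly_eval (sum f A) x = (\<Sum>a\<in>A. poly_eval (f a) x)"
  by (induction A rule: infinite_finite_induct) (auto simp: poly_eval_0 poly_eval_add)

lemma poly_eval_single: "poly_eval (Poly_Mapping.single m c) x = c * monomial_fun m x"
  by (simp add: poly_eval_superset[of "{m}"])

lemma polys_in_single: "c = 0 \<or> Poly_Mapping.keys m \<subseteq> I \<Longrightarrow> Poly_Mapping.single m c \<in> polys_in I"
  by (auto simp: polys_in_def)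

lemma polys_in_add: "p \<in> polys_in I \<Longrightarrow> q \<in> polys_in I \<Longrightarrow> p + q \<in> polys_in I"
  unfolding polys_in_def using Poly_Mapping.keys_add[of p q] by blast

lemma coord_in_polyfuns: "v \<in> I \<Longrightarrow> (\<lambda>x. x v) \<in> polyfuns I"
  by (rule subsetD[OF forms_subset_polyfuns coord_in_forms])

lemma prod_in_polyfuns: "(\<And>a. a \<in> A \<Longrightarrow> f a \<in> polyfuns I) \<Longrightarrow> prod f A \<in> polyfuns I"
proof (induction A rule: infinite_finite_induct)
  case (insert a A)
  then show ?case by (simp add: polyfuns_mult)
qed (use const_in_polyfuns[of 1 I] in \<open>auto simp: one_fun_def\<close>)

lemma monomial_fun_in_polyfuns:
  assumes "Poly_Mapping.keys m \<subseteq> I" shows "monomial_fun m \<in> polyfuns I"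
proof -
  have "monomial_fun m = (\<Prod>v\<in>Poly_Mapping.keys m. (\<lambda>x. x v) ^ Poly_Mapping.lookup m v)"
    by (simp add: fun_eq_iff monomial_fun_def prod_fun_apply power_fun_apply)
  then show ?thesis
    using assms by (auto intro!: prod_in_polyfuns power_in_polyfuns coord_in_polyfuns)
qed

lemma poly_eval_in_polyfuns:
  assumes "p \<in> polys_in I" shows "poly_eval p \<in> polyfuns I"
proof -
  have "poly_eval p = (\<Sum>m\<in>Poly_Mapping.keys p. fscale (Poly_Mapping.lookup p m) (monomial_fun m))"
    by (simp add: fun_eq_iff sum_fun_apply fscale_apply poly_eval_superset[of "Poly_Mapping.keys p"])
  then show ?thesis
    using assms by (auto simp: polys_in_def intro!: fs.subspace_sum[OF subspace_polyfuns]
        fs.subspace_scale[OF subspace_polyfuns] monomial_fun_in_polyfuns)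
qed

lemma keys_word: "Poly_Mapping.keys (\<Sum>v\<leftarrow>vs. Poly_Mapping.single v (1::nat)) \<subseteq> set vs"
proof (induction vs)
  case (Cons v vs)
  then show ?case
    using Poly_Mapping.keys_add[of "Poly_Mapping.single v (1::nat)" "\<Sum>v\<leftarrow>vs. Poly_Mapping.single v 1"]
    by auto
qed simp

lemma polyfuns_eq: "polyfuns I = poly_eval ` polys_in I"
proof
  show "poly_eval ` polys_in I \<subseteq> polyfuns I" using poly_eval_in_polyfuns by blast
  show "polyfuns I \<subseteq> poly_eval ` polys_in I"
  proof
    fix f assume "f \<in> polyfuns I"
    then show "f \<in> poly_eval ` polys_in I"
      unfolding polyfuns_def
    proof (induction rule: fs.span_induct_alt)
      case base
      have "0 = poly_eval (0 :: 'a cpoly)" by (simp add: fun_eq_iff poly_eval_0 zero_fun_apply)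
      then show ?case by (auto simp: polys_in_def)
    next
      case (step c g h)
      then obtain vs p where *: "g = word_fun vs" "set vs \<subseteq> I" "h = poly_eval p" "p \<in> polys_in I"
        by auto
      let ?q = "Poly_Mapping.single (\<Sum>v\<leftarrow>vs. Poly_Mapping.single v 1) c + p"
      have "fscale c g + h = poly_eval ?q"
        by (simp add: * fun_eq_iff poly_eval_add poly_eval_single monomial_fun_word
            plus_fun_apply fscale_apply del: One_nat_def)
      moreover have "?q \<in> polys_in I"
        using * keys_word[of vs] by (intro polys_in_add polys_in_single) auto
      ultimately show ?case by blast
    qed
  qed
qed

lemma zariski_closed_iff:
  "zariski_closed I Z \<longleftrightarrow>
     (\<exists>S\<subseteq>polyfuns I. Z = {x \<in> affine_space I. \<forall>f\<in>S. f x = 0})"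
proof
  assume "zariski_closed I Z"
  then obtain S where "S \<subseteq> polys_in I" "Z = {x \<in> affine_space I. \<forall>p\<in>S. poly_eval p x = 0}"
    unfolding zariski_closed_def by blast
  then show "\<exists>S\<subseteq>polyfuns I. Z = {x \<in> affine_space I. \<forall>f\<in>S. f x = 0}"
    by (intro exI[of _ "poly_eval ` S"]) (auto simp: polyfuns_eq)
next
  assume "\<exists>S\<subseteq>polyfuns I. Z = {x \<in> affine_space I. \<forall>f\<in>S. f x = 0}"
  then obtain S where S: "S \<subseteq> poly_eval ` polys_in I" "Z = {x \<in> affine_space I. \<forall>f\<in>S. f x = 0}"
    unfolding polyfuns_eq by blast
  obtain P where P: "P \<subseteq> polys_in I" "S = poly_eval ` P" using S(1) by (meson subset_imageE)
  show "zariski_closed I Z"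
    unfolding zariski_closed_def by (rule exI[of _ P]) (use S P in auto)
qed

lemma zariski_closed_subset: "zariski_closed I Z \<Longrightarrow> Z \<subseteq> affine_space I"
  by (auto simp: zariski_closed_def)

lemma zariski_closed_zeros:
  "S \<subseteq> polyfuns I \<Longrightarrow> zariski_closed I {x \<in> affine_space I. \<forall>f\<in>S. f x = 0}"
  unfolding zariski_closed_iff by blast

lemma zariski_closed_Int_zeros:
  assumes "zariski_closed I Z" "S \<subseteq> polyfuns I"
  shows "zariski_closed I {x \<in> Z. \<forall>f\<in>S. f x = 0}"
proof -
  obtain S' where S': "S' \<subseteq> polyfuns I" "Z = {x \<in> affine_space I. \<forall>f\<in>S'. f x = 0}"
    using assms(1) unfolding zariski_closed_iff by (elim exE conjE)
  have "{x \<in> Z. \<forall>f\<in>S. f x = 0} = {x \<in> affine_space I. \<forall>f\<in>S \<union> S'. f x = 0}"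
    using S' by blast
  then show ?thesis using zariski_closed_zeros[of "S \<union> S'" I] assms S' by simp
qed

lemma zariski_closed_separate:
  assumes "zariski_closed I Z" "x \<in> affine_space I" "x \<notin> Z"
  obtains f where "f \<in> polyfuns I" "f x \<noteq> 0" "\<forall>z\<in>Z. f z = 0"
  using assms unfolding zariski_closed_iff by blast

lemma zariski_closed_Int:
  assumes "zariski_closed I A" "zariski_closed I B" shows "zariski_closed I (A \<inter> B)"
proof -
  obtain S where S: "S \<subseteq> polyfuns I" "A = {x \<in> affine_space I. \<forall>f\<in>S. f x = 0}"
    using assms(1) unfolding zariski_closed_iff by (elim exE conjE)
  then have "A \<inter> B = {x \<in> B. \<forall>f\<in>S. f x = 0}"
    using zariski_closed_subset[OF assms(2)] by blast
  then show ?thesis using zariski_closed_Int_zeros[OF assms(2) S(1)] by simp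
qed

lemma zariski_closed_Un:
  assumes "zariski_closed I A" "zariski_closed I B" shows "zariski_closed I (A \<union> B)"
proof -
  obtain S where S: "S \<subseteq> polyfuns I" "A = {x \<in> affine_space I. \<forall>f\<in>S. f x = 0}"
    using assms(1) unfolding zariski_closed_iff by (elim exE conjE)
  obtain T where T: "T \<subseteq> polyfuns I" "B = {x \<in> affine_space I. \<forall>f\<in>T. f x = 0}"
    using assms(2) unfolding zariski_closed_iff by (elim exE conjE)
  let ?P = "{f * g | f g. f \<in> S \<and> g \<in> T}"
  have "A \<union> B = {x \<in> affine_space I. \<forall>f\<in>?P. f x = 0}"
    unfolding S T by (auto simp: times_fun_apply) (use mult_eq_0_iff times_fun_apply in metis)
  moreover have "?P \<subseteq> polyfuns I" using S T polyfuns_mult by blast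
  ultimately show ?thesis using zariski_closed_zeros[of ?P I] by (simp only:)
qed

text \<open>
  The zero sets of \<open>f\<close> and of \<open>g\<close> in \<open>Y\<close> are closed and cover \<open>Y\<close>.
\<close>

lemma irreducible_closed_prime:
  assumes Y: "irreducible_closed I Y" and f: "f \<in> polyfuns I" and g: "g \<in> polyfuns I"
    and fg: "\<forall>y\<in>Y. f y * g y = 0"
  shows "(\<forall>y\<in>Y. f y = 0) \<or> (\<forall>y\<in>Y. g y = 0)"
proof -
  have c: "zariski_closed I Y" using Y by (simp add: irreducible_closed_def)
  have "Y = {y \<in> Y. \<forall>h\<in>{f}. h y = 0} \<union> {y \<in> Y. \<forall>h\<in>{g}. h y = 0}" using fg by auto
  moreover have "zariski_closed I {y \<in> Y. \<forall>h\<in>{f}. h y = 0}"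
    "zariski_closed I {y \<in> Y. \<forall>h\<in>{g}. h y = 0}"
    using zariski_closed_Int_zeros[OF c] f g by blast+
  ultimately have "Y = {y \<in> Y. \<forall>h\<in>{f}. h y = 0} \<or> Y = {y \<in> Y. \<forall>h\<in>{g}. h y = 0}"
    using Y unfolding irreducible_closed_def by blast
  then show ?thesis by blast
qed

section \<open>The descending chain condition for closed sets\<close>

lemma nat_seq_incseq_subseq:
  fixes s :: "nat \<Rightarrow> nat"
  obtains \<phi> :: "nat \<Rightarrow> nat" where "strict_mono \<phi>" "\<forall>i j. i \<le> j \<longrightarrow> s (\<phi> i) \<le> s (\<phi> j)"
proof -
  obtain \<psi> :: "nat \<Rightarrow> nat" where \<psi>: "strict_mono \<psi>" "monoseq (\<lambda>n. s (\<psi> n))"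
    using seq_monosub[of s] by blast
  from \<psi>(2) consider "\<forall>m. \<forall>n\<ge>m. s (\<psi> m) \<le> s (\<psi> n)" | "\<forall>m. \<forall>n\<ge>m. s (\<psi> n) \<le> s (\<psi> m)"
    unfolding monoseq_def by blast
  then show ?thesis
  proof cases
    case 1
    then show ?thesis using that[of \<psi>] \<psi>(1) by blast
  next
    case 2
    obtain n0 where n0: "\<And>n. s (\<psi> n0) \<le> s (\<psi> n)"
      using ex_has_least_nat[of "\<lambda>_. True" _ "\<lambda>n. s (\<psi> n)"] by auto
    have "s (\<psi> (n0 + i)) = s (\<psi> n0)" for i using n0[of "n0 + i"] 2 by (simp add: order_antisym)
    moreover have "strict_mono (\<lambda>i. \<psi> (n0 + i))"
      using \<psi>(1) by (simp add: strict_mono_def)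
    ultimately show ?thesis using that[of "\<lambda>i. \<psi> (n0 + i)"] by simp
  qed
qed

lemma dickson_subsequence:
  fixes s :: "nat \<Rightarrow> nat list"
  assumes "\<And>i. length (s i) = N"
  shows "\<exists>\<phi> :: nat \<Rightarrow> nat. strict_mono \<phi> \<and> (\<forall>i j. i \<le> j \<longrightarrow> list_all2 (\<le>) (s (\<phi> i)) (s (\<phi> j)))"
  using assms
proof (induction N arbitrary: s)
  case 0
  then show ?case by (intro exI[of _ id]) (auto simp: strict_mono_def)
next
  case (Suc N)
  obtain \<phi> :: "nat \<Rightarrow> nat" where \<phi>: "strict_mono \<phi>" "\<And>i j. i \<le> j \<Longrightarrow> list_all2 (\<le>) (tl (s (\<phi> i))) (tl (s (\<phi> j)))"
    using Suc.IH[of "\<lambda>i. tl (s i)"] Suc.prems by auto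
  obtain \<psi> :: "nat \<Rightarrow> nat" where \<psi>: "strict_mono \<psi>"
      "\<forall>i j. i \<le> j \<longrightarrow> hd (s (\<phi> (\<psi> i))) \<le> hd (s (\<phi> (\<psi> j)))"
    by (rule nat_seq_incseq_subseq[of "\<lambda>i. hd (s (\<phi> i))"])
  have "list_all2 (\<le>) (s (\<phi> (\<psi> i))) (s (\<phi> (\<psi> j)))" if "i \<le> j" for i j
  proof -
    have ne: "s k = hd (s k) # tl (s k)" for k using Suc.prems[of k] by (cases "s k") auto
    have "\<psi> i \<le> \<psi> j" using \<psi>(1) that by (simp add: strict_mono_less_eq)
    then show ?thesis
      using \<phi>(2) \<psi>(2) that by (subst (1 2) ne) auto
  qed
  then show ?case
    using \<phi>(1) \<psi>(1) by (intro exI[of _ "\<lambda>i. \<phi> (\<psi> i)"]) (auto simp: strict_mono_def)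
qed

text \<open>
  For leading terms, monomials are given by exponent lists of a fixed length, along an
  enumeration of the variables. The lexicographic order is well-founded on these lists, total, and
  compatible with addition.
\<close>

abbreviation lex_less :: "nat \<Rightarrow> (nat list \<times> nat list) set" where
  "lex_less N \<equiv> lexn less_than N"

lemma lex_less_Cons:
  "(x # xs, y # ys) \<in> lex_less (Suc N) \<longleftrightarrow>
     length xs = N \<and> length ys = N \<and> (x < y \<or> x = y \<and> (xs, ys) \<in> lex_less N)"
proof
  assume "(x # xs, y # ys) \<in> lex_less (Suc N)"
  then show "length xs = N \<and> length ys = N \<and> (x < y \<or> x = y \<and> (xs, ys) \<in> lex_less N)"
    by auto
next
  assume "length xs = N \<and> length ys = N \<and> (x < y \<or> x = y \<and> (xs, ys) \<in> lex_less N)"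
  then have "((x, xs), (y, ys)) \<in> less_than <*lex*> lex_less N" by auto
  then have "map_prod (\<lambda>(x, xs). x # xs) (\<lambda>(x, xs). x # xs) ((x, xs), (y, ys))
      \<in> map_prod (\<lambda>(x, xs). x # xs) (\<lambda>(x, xs). x # xs) ` (less_than <*lex*> lex_less N)"
    by (rule imageI)
  then show "(x # xs, y # ys) \<in> lex_less (Suc N)"
    using \<open>length xs = N \<and> _\<close> by auto
qed

lemma lex_less_total:
  "length xs = N \<Longrightarrow> length ys = N \<Longrightarrow> xs \<noteq> ys \<Longrightarrow> (xs, ys) \<in> lex_less N \<or> (ys, xs) \<in> lex_less N"
proof (induction N arbitrary: xs ys)
  case (Suc N)
  then obtain x xs' y ys' where "xs = x # xs'" "ys = y # ys'" by (metis length_Suc_conv)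
  then show ?case using Suc unfolding lex_less_Cons by (cases x y rule: linorder_cases)
      (auto simp del: lexn.simps simp: lex_less_Cons)
qed auto

lemma lex_less_trans: "(a, b) \<in> lex_less N \<Longrightarrow> (b, c) \<in> lex_less N \<Longrightarrow> (a, c) \<in> lex_less N"
  using lexn_transI[OF trans_less_than, of N] by (blast dest: transD)

lemma lex_less_add:
  "length d = N \<Longrightarrow> (a, b) \<in> lex_less N \<Longrightarrow> (map2 (+) d a, map2 (+) d b) \<in> lex_less N"
proof (induction N arbitrary: a b d)
  case (Suc N)
  then obtain x xs y ys z zs where "a = x # xs" "b = y # ys" "d = z # zs"
    using lexn_length[OF Suc.prems(2)] by (metis length_Suc_conv)
  then show ?case using Suc by (auto simp del: lexn.simps simp: lex_less_Cons)
qed auto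

lemma lex_less_max:
  assumes "finite T" "T \<noteq> {}" "\<And>e. e \<in> T \<Longrightarrow> length e = N"
  shows "\<exists>e\<in>T. \<forall>e'\<in>T. e' = e \<or> (e', e) \<in> lex_less N"
  using assms
proof (induction rule: finite_ne_induct)
  case (insert x T)
  then obtain e where e: "e \<in> T" "\<forall>e'\<in>T. e' = e \<or> (e', e) \<in> lex_less N" by auto
  have "x \<noteq> e" using e insert by auto
  then consider "(x, e) \<in> lex_less N" | "(e, x) \<in> lex_less N"
    using lex_less_total[of x N e] insert.prems e(1) by auto
  then show ?case
  proof cases
    case 1 then show ?thesis using e by blast
  next
    case 2
    have "(e', x) \<in> lex_less N" if "e' \<in> T" for e'
    proof (cases "e' = e")
      case False
      then have "(e', e) \<in> lex_less N" using e(2) that by blast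
      then show ?thesis by (rule lex_less_trans[OF _ 2])
    qed (use 2 in simp)
    then show ?thesis by blast
  qed
qed simp

definition exp_fun :: "'v list \<Rightarrow> nat list \<Rightarrow> ('v \<Rightarrow> complex) \<Rightarrow> complex" where
  "exp_fun vs e x = prod_list (map2 (\<lambda>v k. x v ^ k) vs e)"

lemma exp_fun_Nil [simp]: "exp_fun [] e x = 1" "exp_fun vs [] x = 1"
  by (simp_all add: exp_fun_def)

lemma exp_fun_Cons [simp]: "exp_fun (v # vs) (k # e) x = x v ^ k * exp_fun vs e x"
  by (simp add: exp_fun_def)

lemma exp_fun_add_apply:
  "length d = length vs \<Longrightarrow> length e = length vs \<Longrightarrow>
     exp_fun vs (map2 (+) d e) x = exp_fun vs d x * exp_fun vs e x"
proof (induction vs arbitrary: d e)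
  case (Cons v vs)
  then obtain z zs y ys where "d = z # zs" "e = y # ys" by (cases d; cases e; simp)
  then show ?case using Cons by (simp add: power_add)
qed simp

lemma exp_fun_add:
  "length d = length vs \<Longrightarrow> length e = length vs \<Longrightarrow>
     exp_fun vs (map2 (+) d e) = exp_fun vs d * exp_fun vs e"
  by (simp add: fun_eq_iff times_fun_apply exp_fun_add_apply)

definition exp_span :: "'v list \<Rightarrow> nat list \<Rightarrow> (('v \<Rightarrow> complex) \<Rightarrow> complex) set" where
  "exp_span vs e = fs.span {exp_fun vs e' | e'. (e', e) \<in> lex_less (length vs)}"

lemma exp_fun_coord:
  assumes "distinct vs" "u \<in> set vs"
  shows "exp_fun vs (map (\<lambda>w. if w = u then 1 else 0) vs) = (\<lambda>x. x u)"
proof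
  fix x :: "'a \<Rightarrow> complex"
  have 0: "exp_fun vs (map (\<lambda>w. if w = u then 1 else 0) vs) x = 1" if "u \<notin> set vs" for vs
    using that by (induction vs) auto
  show "exp_fun vs (map (\<lambda>w. if w = u then 1 else 0) vs) x = x u"
    using assms
  proof (induction vs)
    case (Cons v vs)
    then show ?case using 0[of vs] by (cases "v = u") auto
  qed auto
qed

lemma polyfuns_subset_exp_funs:
  assumes "distinct vs"
  shows "polyfuns (set vs) \<subseteq> fs.span {exp_fun vs e | e. length e = length vs}"
proof -
  define E where "E = {exp_fun vs e | e. length e = length vs}"
  have E: "exp_fun vs e \<in> fs.span E" if "length e = length vs" for e
    unfolding E_def by (rule fs.span_base) (use that in blast)
  have "word_fun us \<in> fs.span E" if "set us \<subseteq> set vs" for us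
    using that
  proof (induction us)
    case Nil
    have "exp_fun vs (map (\<lambda>_. 0) vs) x = 1" for x
      by (induction vs) auto
    then have "exp_fun vs (map (\<lambda>_. 0) vs) = word_fun []"
      by (simp add: fun_eq_iff one_fun_apply)
    then show ?case using E[of "map (\<lambda>_. 0) vs"] by simp
  next
    case (Cons u us)
    have "(\<lambda>x. x u) \<in> fs.span E"
      using exp_fun_coord[OF assms, of u] Cons.prems E[of "map (\<lambda>w. if w = u then 1 else 0) vs"]
      by simp
    moreover have "word_fun us \<in> fs.span E" using Cons by simp
    ultimately have "(\<lambda>x. x u) * word_fun us \<in> fs.span E"
    proof (rule span_mult)
      fix a b assume "a \<in> E" "b \<in> E"
      then obtain d e where "a = exp_fun vs d" "b = exp_fun vs e" "length d = length vs" "length e = length vs"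
        unfolding E_def by blast
      then show "a * b \<in> fs.span E"
        using E[of "map2 (+) d e"] exp_fun_add[of d vs e] by simp
    qed
    moreover have "(\<lambda>x. x u) * word_fun us = word_fun (u # us)"
      by (simp add: fun_eq_iff word_fun_def times_fun_apply)
    ultimately show ?case by simp
  qed
  then have "{word_fun us | us. set us \<subseteq> set vs} \<subseteq> fs.span E" by blast
  then show ?thesis unfolding polyfuns_def E_def by (rule fs.span_minimal) simp
qed

text \<open>
  Take any representation of \<open>f\<close> with nonzero coefficients, and the largest exponent in it. The
  result may depend on the representation; minimality is imposed later, over all of them at once.
\<close>

lemma leading_exponent:
  assumes "f \<in> fs.span {exp_fun vs e | e. e \<in> E}" "f \<noteq> 0" and len: "\<And>e. e \<in> E \<Longrightarrow> length e = length vs"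
  obtains e c where "e \<in> E" "c \<noteq> 0" "f - fscale c (exp_fun vs e) \<in> exp_span vs e"
proof -
  obtain t r where t: "finite t" "t \<subseteq> {exp_fun vs e | e. e \<in> E}"
    "f = (\<Sum>a\<in>t. fscale (r a) a)"
    using assms(1) unfolding fs.span_explicit by blast
  have "\<forall>a\<in>t. \<exists>e. a = exp_fun vs e \<and> e \<in> E" using t(2) by blast
  then obtain ex where ex: "\<forall>a\<in>t. a = exp_fun vs (ex a) \<and> ex a \<in> E" by (rule bchoice[THEN exE])
  define t' where "t' = {a \<in> t. r a \<noteq> 0}"
  have f: "f = (\<Sum>a\<in>t'. fscale (r a) a)"
    unfolding t(3) t'_def by (rule sum.mono_neutral_right) (use t in auto)
  have "t' \<noteq> {}" using f assms(2) by auto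
  moreover have "finite t'" using t by (simp add: t'_def)
  ultimately obtain e where e: "e \<in> ex ` t'" "\<forall>e'\<in>ex ` t'. e' = e \<or> (e', e) \<in> lex_less (length vs)"
    using lex_less_max[of "ex ` t'" "length vs"] ex len t'_def by blast
  then obtain a where a: "a \<in> t'" "e = ex a" by blast
  have "f - fscale (r a) (exp_fun vs e) = (\<Sum>b\<in>t' - {a}. fscale (r b) b)"
    unfolding f using a \<open>finite t'\<close> ex by (simp add: t'_def sum_diff1)
  also have "\<dots> \<in> exp_span vs e"
    unfolding exp_span_def
  proof (intro fs.span_sum fs.span_scale fs.span_base)
    fix b assume b: "b \<in> t' - {a}"
    then have "a \<in> t" "b \<in> t" "a \<noteq> b" using a by (auto simp: t'_def)
    then have "ex b \<noteq> e" using ex a(2) by metis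
    then have "(ex b, e) \<in> lex_less (length vs)" using e b by blast
    then show "b \<in> {exp_fun vs e' | e'. (e', e) \<in> lex_less (length vs)}"
      using ex b by (auto simp: t'_def)
  qed
  finally show ?thesis using that[of e "r a"] a ex by (auto simp: t'_def)
qed

lemma exp_fun_mult_exp_span:
  assumes "f \<in> exp_span vs e" "length d = length vs"
  shows "exp_fun vs d * f \<in> exp_span vs (map2 (+) d e)"
  unfolding exp_span_def
proof (rule span_mult[of _ "{exp_fun vs d}"])
  show "exp_fun vs d \<in> fs.span {exp_fun vs d}" by (simp add: fs.span_base)
  show "f \<in> fs.span {exp_fun vs e' |e'. (e', e) \<in> lex_less (length vs)}"
    using assms(1) by (simp add: exp_span_def)
  fix a b assume "a \<in> {exp_fun vs d}" "b \<in> {exp_fun vs e' |e'. (e', e) \<in> lex_less (length vs)}"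
  then obtain e' where *: "a = exp_fun vs d" "b = exp_fun vs e'" "(e', e) \<in> lex_less (length vs)" by blast
  then have "a * b = exp_fun vs (map2 (+) d e')"
    using exp_fun_add[of d vs e'] assms(2) lexn_length[OF *(3)] by auto
  then show "a * b \<in> fs.span {exp_fun vs e'' |e''. (e'', map2 (+) d e) \<in> lex_less (length vs)}"
    using lex_less_add[OF assms(2) *(3)] by (intro fs.span_base) blast
qed

lemma list_diff_add:
  "list_all2 (\<le>) a b \<Longrightarrow> map2 (+) (map2 (-) b a) a = (b :: nat list)"
  by (induction rule: list_all2_induct) auto

text \<open>
  The cancellation step: if the leading monomial of \<open>f\<close> divides that of \<open>g\<close>, then a monomial
  multiple of \<open>f\<close> removes the leading term of \<open>g\<close>.
\<close>

lemma leading_term_cancel: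
  assumes f: "f - fscale c (exp_fun vs e) \<in> exp_span vs e" and c: "c \<noteq> 0"
    and g: "g - fscale b (exp_fun vs e') \<in> exp_span vs e'"
    and le: "list_all2 (\<le>) e e'" and len: "length e = length vs" "length e' = length vs"
  shows "g - fscale (b / c) (exp_fun vs (map2 (-) e' e) * f) \<in> exp_span vs e'"
proof -
  let ?d = "map2 (-) e' e"
  have d: "length ?d = length vs" "map2 (+) ?d e = e'"
    using len list_diff_add[OF le] by auto
  have "exp_fun vs ?d * (f - fscale c (exp_fun vs e)) \<in> exp_span vs e'"
    using exp_fun_mult_exp_span[OF f d(1)] d(2) by simp
  then have "(g - fscale b (exp_fun vs e'))
      - fscale (b / c) (exp_fun vs ?d * (f - fscale c (exp_fun vs e))) \<in> exp_span vs e'"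
    using fs.span_diff[OF g[unfolded exp_span_def] fs.span_scale] unfolding exp_span_def by blast
  also have "(g - fscale b (exp_fun vs e'))
      - fscale (b / c) (exp_fun vs ?d * (f - fscale c (exp_fun vs e)))
      = g - fscale (b / c) (exp_fun vs ?d * f)"
    using exp_fun_add[OF d(1) len(1)] c unfolding d(2)
    by (simp add: pointwise algebra_simps)
  finally show ?thesis .
qed

text \<open>
  Hilbert's basis theorem in disguise, by Dickson's lemma and leading monomials. For each step of a
  strictly descending chain of closed sets pick a function that vanishes on the smaller set but not
  on the larger one, with the lexicographically least possible leading monomial. By Dickson's lemma
  one of these monomials divides a later one. Subtracting a multiple of the earlier function from
  the later one lowers the leading monomial and does not change the values on the sets of the later
  step, because the earlier function vanishes there. This contradicts minimality.

  In the proof \<open>D j\<close> consists of the functions that separate \<open>Z (Suc j)\<close> from \<open>Z j\<close>, \<open>L j\<close> of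
  their possible leading exponents, and \<open>e j\<close> is a least element of \<open>L j\<close>.
\<close>

lemma no_descending_closed_chain:
  assumes "finite I" and Z: "\<And>j. zariski_closed I (Z j)" "\<And>j. Z (Suc j) \<subset> Z j"
  shows False
proof -
  obtain vs where vs: "distinct vs" "set vs = I" using finite_distinct_list[OF assms(1)] by blast
  let ?N = "length vs"
  have anti: "Z j \<subseteq> Z i" if "i \<le> j" for i j
    using lift_Suc_antimono_le[of Z i j] Z(2) that by blast
  define D where "D j = {f \<in> polyfuns I. (\<forall>z\<in>Z (Suc j). f z = 0) \<and> (\<exists>z\<in>Z j. f z \<noteq> 0)}" for j
  have lead: "\<exists>e c. length e = ?N \<and> c \<noteq> 0 \<and> f - fscale c (exp_fun vs e) \<in> exp_span vs e"
    if "f \<in> D j" for f j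
  proof -
    have "f \<in> fs.span {exp_fun vs e | e. e \<in> {e. length e = ?N}}"
      using polyfuns_subset_exp_funs[OF vs(1)] that vs(2) by (auto simp: D_def)
    moreover have "f \<noteq> 0" using that by (auto simp: D_def zero_fun_apply)
    ultimately show ?thesis by (rule leading_exponent) auto
  qed
  define L where "L j = {e. length e = ?N \<and> (\<exists>f\<in>D j. \<exists>c. c \<noteq> 0 \<and> f - fscale c (exp_fun vs e) \<in> exp_span vs e)}" for j
  have "\<exists>e\<in>L j. \<forall>e'\<in>L j. (e', e) \<notin> lex_less ?N" for j
  proof -
    obtain z where z: "z \<in> Z j" "z \<notin> Z (Suc j)" using Z(2)[of j] by blast
    have "z \<in> affine_space I" using zariski_closed_subset[OF Z(1)[of j]] z by blast
    then obtain f where "f \<in> polyfuns I" "f z \<noteq> 0" "\<forall>y\<in>Z (Suc j). f y = 0"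
      using zariski_closed_separate[OF Z(1)[of "Suc j"] _ z(2)] by blast
    then have "f \<in> D j" using z by (auto simp: D_def)
    then obtain e0 where "e0 \<in> L j" using lead[of f j] by (auto simp: L_def)
    from wfE_min[OF wf_lexn[OF wf_less_than] this] show ?thesis by metis
  qed
  then obtain e where e: "\<And>j. e j \<in> L j" "\<And>j e'. e' \<in> L j \<Longrightarrow> (e', e j) \<notin> lex_less ?N"
    by metis
  have len: "length (e j) = ?N" for j using e(1)[of j] by (simp add: L_def)
  obtain \<phi> :: "nat \<Rightarrow> nat" where \<phi>: "strict_mono \<phi>" "\<And>i j. i \<le> j \<Longrightarrow> list_all2 (\<le>) (e (\<phi> i)) (e (\<phi> j))"
    using dickson_subsequence[of e ?N] len by blast
  define i j where "i = \<phi> 0" and "j = \<phi> 1"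
  have ij: "i < j" "list_all2 (\<le>) (e i) (e j)"
    using \<phi>(1) \<phi>(2)[of 0 1] by (auto simp: i_def j_def strict_mono_def)
  obtain f c where f: "f \<in> D i" "c \<noteq> 0" "f - fscale c (exp_fun vs (e i)) \<in> exp_span vs (e i)"
    using e(1)[of i] by (auto simp: L_def)
  obtain g b where g: "g \<in> D j" "b \<noteq> 0" "g - fscale b (exp_fun vs (e j)) \<in> exp_span vs (e j)"
    using e(1)[of j] by (auto simp: L_def)
  define h where "h = g - fscale (b / c) (exp_fun vs (map2 (-) (e j) (e i)) * f)"
  have h_low: "h \<in> exp_span vs (e j)"
    unfolding h_def by (rule leading_term_cancel[OF f(3,2) g(3) ij(2) len len])
  have hz: "h z = g z" if "z \<in> Z j" for z
  proof -
    have "Z j \<subseteq> Z (Suc i)" using anti[of "Suc i" j] ij by simp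
    then have "f z = 0" using f(1) that by (auto simp: D_def)
    then show ?thesis by (simp add: h_def pointwise)
  qed
  have exp_in: "exp_fun vs d \<in> polyfuns I" for d
  proof -
    have "prod_list (map (\<lambda>(v, k). (\<lambda>x. x v) ^ k) (zip us d)) \<in> polyfuns I"
      if "set us \<subseteq> I" for us :: "'a list"
      using that
    proof (induction us arbitrary: d)
      case Nil
      then show ?case using const_in_polyfuns[of 1 I] by (simp add: one_fun_def)
    next
      case (Cons u us)
      then show ?case
        using const_in_polyfuns[of 1 I]
        by (cases d) (auto simp: one_fun_def intro!: polyfuns_mult power_in_polyfuns coord_in_polyfuns)
    qed
    moreover have "exp_fun us d = prod_list (map (\<lambda>(v, k). (\<lambda>x. x v) ^ k) (zip us d))"
      for us :: "'a list"
    proof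
      fix x
      show "exp_fun us d x = prod_list (map (\<lambda>(v, k). (\<lambda>x. x v) ^ k) (zip us d)) x"
      proof (induction us arbitrary: d)
        case (Cons u us)
        then show ?case by (cases d) (auto simp: times_fun_apply power_fun_apply one_fun_apply)
      qed (simp add: one_fun_apply)
    qed
    ultimately show ?thesis using vs by simp
  qed
  have "h \<in> polyfuns I"
    unfolding h_def using f(1) g(1) exp_in
    by (intro fs.subspace_diff[OF subspace_polyfuns] fs.subspace_scale[OF subspace_polyfuns] polyfuns_mult)
      (auto simp: D_def)
  moreover have "\<forall>z\<in>Z (Suc j). h z = 0" "\<exists>z\<in>Z j. h z \<noteq> 0"
    using hz g(1) anti[of j "Suc j"] by (auto simp: D_def)
  ultimately have hD: "h \<in> D j" by (simp add: D_def)
  have "h \<noteq> 0" using hD by (auto simp: D_def zero_fun_apply)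
  have "h \<in> fs.span {exp_fun vs e' | e'. e' \<in> {e'. (e', e j) \<in> lex_less ?N}}"
    using h_low by (simp add: exp_span_def)
  from this \<open>h \<noteq> 0\<close> obtain e' c' where e': "e' \<in> {e'. (e', e j) \<in> lex_less ?N}" "c' \<noteq> 0"
      "h - fscale c' (exp_fun vs e') \<in> exp_span vs e'"
    by (rule leading_exponent) (auto dest: lexn_length)
  then have "e' \<in> L j" using hD lexn_length[of e' "e j"] unfolding L_def by blast
  then show False using e(2)[of e' j] e' by simp
qed

section \<open>Cones\<close>

text \<open>
  Points of affine space are undefined outside the index set, hence the restriction.
\<close>

definition scale_point :: "'v set \<Rightarrow> complex \<Rightarrow> ('v \<Rightarrow> complex) \<Rightarrow> 'v \<Rightarrow> complex" where
  "scale_point I t x = (\<lambda>v\<in>I. t * x v)"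

definition closed_cone :: "'v set \<Rightarrow> ('v \<Rightarrow> complex) set \<Rightarrow> bool" where
  "closed_cone I X \<longleftrightarrow> zariski_closed I X \<and> (\<forall>x\<in>X. \<forall>t. scale_point I t x \<in> X)"

lemma polyfuns_scale_point:
  "f \<in> polyfuns I \<Longrightarrow> f (scale_point I t x) = f (\<lambda>v. t * x v)"
  by (rule polyfuns_cong[of f I]) (auto simp: scale_point_def)

lemma forms_scale_point:
  assumes "f \<in> forms I m" shows "f (scale_point I t x) = t ^ m * f x"
proof -
  have "f (scale_point I t x) = f (\<lambda>v. t * x v)"
    by (rule polyfuns_scale_point[OF subsetD[OF forms_subset_polyfuns assms]])
  also have "\<dots> = t ^ m * f x" by (rule forms_homogeneous[OF assms])
  finally show ?thesis .
qed

text \<open>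
  A closed cone is the zero set of the forms that vanish on it: if a polynomial vanishes on the
  cone, then it vanishes on the lines through the origin contained in it, hence so do its
  homogeneous parts.
\<close>

lemma closed_cone_memberI:
  assumes X: "closed_cone I X" and x: "x \<in> affine_space I"
    and zero: "\<And>m f. f \<in> forms I m \<Longrightarrow> \<forall>y\<in>X. f y = 0 \<Longrightarrow> f x = 0"
  shows "x \<in> X"
proof (rule ccontr)
  assume "x \<notin> X"
  have "zariski_closed I X" using X unfolding closed_cone_def by blast
  then obtain f where f: "f \<in> polyfuns I" "f x \<noteq> 0" "\<forall>y\<in>X. f y = 0"
    using x \<open>x \<notin> X\<close> by (rule zariski_closed_separate)
  obtain D h where h: "\<forall>m. h m \<in> forms I m" "f = (\<Sum>m\<le>D. h m)"
    by (rule polyfuns_graded[OF f(1)])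
  have "h m x = 0" if m: "m \<le> D" for m
  proof (rule zero[OF h(1)[rule_format]], rule ballI)
    fix y assume y: "y \<in> X"
    have "f (\<lambda>v. t * y v) = 0" for t
      using X f(3) y polyfuns_scale_point[OF f(1), of t y] by (auto simp: closed_cone_def)
    then have "\<forall>t. (\<Sum>m\<le>D. h m) (\<lambda>v. t * y v) = 0" using h(2) by simp
    then show "h m y = 0"
      using graded_part_vanishes[of h I D y m] h(1) m by blast
  qed
  then have "f x = 0" by (simp add: h(2) sum_fun_apply)
  then show False using f(2) by simp
qed

text \<open>
  The forms that agree on \<open>X\<close> with an element of the ideal generated by the linear forms in \<open>L\<close>,
  that is, the ideal of \<open>X\<close> plus that ideal. In degree zero the cofactors have to vanish.
\<close>

definition combinations_on ::
    "'v set \<Rightarrow> ('v \<Rightarrow> complex) set \<Rightarrow> (('v \<Rightarrow> complex) \<Rightarrow> complex) set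
      \<Rightarrow> (nat \<times> (('v \<Rightarrow> complex) \<Rightarrow> complex)) set" where
  "combinations_on I X L =
     {(m, f). f \<in> forms I m \<and> (\<exists>h. (\<forall>l\<in>L. h l \<in> (if 1 \<le> m then forms I (m - 1) else {0})) \<and>
        (\<forall>x\<in>X. f x = (\<Sum>l\<in>L. h l x * l x)))}"

lemma combinations_onI:
  assumes "f \<in> forms I m" "\<forall>l\<in>L. h l \<in> (if 1 \<le> m then forms I (m - 1) else {0})"
    "\<forall>x\<in>X. f x = (\<Sum>l\<in>L. h l x * l x)"
  shows "(m, f) \<in> combinations_on I X L"
  unfolding combinations_on_def using assms by blast

lemma combinations_onE:
  assumes "(m, f) \<in> combinations_on I X L"
  obtains h where "f \<in> forms I m" "\<forall>l\<in>L. h l \<in> (if 1 \<le> m then forms I (m - 1) else {0})"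
    "\<forall>x\<in>X. f x = (\<Sum>l\<in>L. h l x * l x)"
  using assms unfolding combinations_on_def by blast

lemma graded_ideal_combinations_on: "graded_ideal I (combinations_on I X L)"
  unfolding graded_ideal_def
proof (intro conjI allI impI)
  fix m f assume "(m, f) \<in> combinations_on I X L"
  then show "f \<in> forms I m" by (simp add: combinations_on_def)
next
  fix m show "(m, 0) \<in> combinations_on I X L"
    by (rule combinations_onI[where h = "\<lambda>_. 0"])
      (auto simp: zero_fun_apply fs.subspace_0[OF subspace_forms])
next
  fix m f f' assume "(m, f) \<in> combinations_on I X L \<and> (m, f') \<in> combinations_on I X L"
  then have ff: "(m, f) \<in> combinations_on I X L" "(m, f') \<in> combinations_on I X L" by auto
  obtain h where h: "f \<in> forms I m" "\<forall>l\<in>L. h l \<in> (if 1 \<le> m then forms I (m - 1) else {0})"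
    "\<forall>x\<in>X. f x = (\<Sum>l\<in>L. h l x * l x)" by (rule combinations_onE[OF ff(1)])
  obtain h' where h': "f' \<in> forms I m" "\<forall>l\<in>L. h' l \<in> (if 1 \<le> m then forms I (m - 1) else {0})"
    "\<forall>x\<in>X. f' x = (\<Sum>l\<in>L. h' l x * l x)" by (rule combinations_onE[OF ff(2)])
  show "(m, f + f') \<in> combinations_on I X L"
  proof (rule combinations_onI[where h = "\<lambda>l. h l + h' l"])
    show "f + f' \<in> forms I m" using h(1) h'(1) by (rule fs.subspace_add[OF subspace_forms])
    show "\<forall>l\<in>L. h l + h' l \<in> (if 1 \<le> m then forms I (m - 1) else {0})"
    proof
      fix l assume "l \<in> L"
      then show "h l + h' l \<in> (if 1 \<le> m then forms I (m - 1) else {0})"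
        using bspec[OF h(2), of l] bspec[OF h'(2), of l] fs.subspace_add[OF subspace_forms]
        by (cases "1 \<le> m") simp_all
    qed
    show "\<forall>x\<in>X. (f + f') x = (\<Sum>l\<in>L. (h l + h' l) x * l x)"
    proof
      fix x assume "x \<in> X"
      then show "(f + f') x = (\<Sum>l\<in>L. (h l + h' l) x * l x)"
        using bspec[OF h(3), of x] bspec[OF h'(3), of x]
        by (simp only: plus_fun_apply distrib_right sum.distrib)
    qed
  qed
next
  fix m k f g assume "(m, f) \<in> combinations_on I X L \<and> g \<in> forms I k"
  then have f: "(m, f) \<in> combinations_on I X L" and g: "g \<in> forms I k" by auto
  obtain h where h: "f \<in> forms I m" "\<forall>l\<in>L. h l \<in> (if 1 \<le> m then forms I (m - 1) else {0})"
    "\<forall>x\<in>X. f x = (\<Sum>l\<in>L. h l x * l x)" by (rule combinations_onE[OF f])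
  show "(k + m, g * f) \<in> combinations_on I X L"
  proof (rule combinations_onI[where h = "\<lambda>l. g * h l"])
    show "g * f \<in> forms I (k + m)" using g h(1) by (rule forms_mult)
    show "\<forall>l\<in>L. g * h l \<in> (if 1 \<le> k + m then forms I (k + m - 1) else {0})"
    proof
      fix l assume l: "l \<in> L"
      show "g * h l \<in> (if 1 \<le> k + m then forms I (k + m - 1) else {0})"
      proof (cases "1 \<le> m")
        case True
        then have "g * h l \<in> forms I (k + (m - 1))"
          using bspec[OF h(2) l] by (intro forms_mult g) simp
        then show ?thesis using True by simp
      next
        case False
        then have "g * h l = 0" using bspec[OF h(2) l] by (simp add: pointwise)
        then show ?thesis using fs.subspace_0[OF subspace_forms, of I "k + m - 1"] by simp
      qed
    qed
    show "\<forall>x\<in>X. (g * f) x = (\<Sum>l\<in>L. (g * h l) x * l x)"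
    proof
      fix x assume "x \<in> X"
      then show "(g * f) x = (\<Sum>l\<in>L. (g * h l) x * l x)"
        using bspec[OF h(3), of x] by (simp only: times_fun_apply sum_distrib_left mult.assoc)
    qed
  qed
qed

text \<open>
  A common zero of the ideal \<open>combinations_on I X L\<close> is a point of the cone \<open>X\<close> at which all
  members of \<open>L\<close> vanish. If the origin is the only one, then the Nullstellensatz puts all forms
  of some degree into the ideal.
\<close>

lemma cone_forms_combination:
  assumes "finite I" "closed_cone I X" "finite L" "L \<subseteq> forms I 1"
    and trivial: "\<And>x. x \<in> X \<Longrightarrow> \<forall>l\<in>L. l x = 0 \<Longrightarrow> \<forall>v\<in>I. x v = 0"
  obtains M where "\<forall>f\<in>forms I (Suc M). \<exists>h. (\<forall>l\<in>L. h l \<in> forms I M) \<and>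
    (\<forall>x\<in>X. f x = (\<Sum>l\<in>L. h l x * l x))"
proof -
  let ?G = "combinations_on I X L"
  have G: "graded_ideal I ?G" by (rule graded_ideal_combinations_on)
  have "\<not> misses_all_degrees I ?G"
  proof
    assume "misses_all_degrees I ?G"
    then obtain x v where x: "v \<in> I" "x v \<noteq> 0" "\<forall>m f. (m, f) \<in> ?G \<longrightarrow> f x = 0"
      by (rule projective_nullstellensatz[OF assms(1) G])
    define y where "y = restrict x I"
    have y: "f y = f x" if "f \<in> forms I m" for f m
      by (rule polyfuns_cong[of f I, OF subsetD[OF forms_subset_polyfuns that]]) (simp add: y_def)
    have "y \<in> X"
    proof (rule closed_cone_memberI[OF assms(2)])
      show "y \<in> affine_space I" by (simp add: y_def affine_space_def)
      fix m f assume f: "f \<in> forms I m" "\<forall>z\<in>X. f z = 0"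
      have "(m, f) \<in> ?G"
        by (rule combinations_onI[where h = "\<lambda>_. 0"])
          (use f in \<open>auto simp: zero_fun_apply fs.subspace_0[OF subspace_forms]\<close>)
      then show "f y = 0" using x(3) y[OF f(1)] by simp
    qed
    moreover have "l y = 0" if l: "l \<in> L" for l
    proof -
      have l1: "l \<in> forms I 1" using l assms(4) by blast
      have "(1, l) \<in> ?G"
      proof (rule combinations_onI[where h = "\<lambda>l'. if l' = l then 1 else 0"])
        show "l \<in> forms I 1" by (rule l1)
        show "\<forall>l'\<in>L. (if l' = l then 1 else 0) \<in> (if 1 \<le> (1::nat) then forms I (1 - 1) else {0})"
          using one_in_forms fs.subspace_0[OF subspace_forms] by auto
        show "\<forall>x\<in>X. l x = (\<Sum>l'\<in>L. (if l' = l then 1 else 0) x * l' x)"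
        proof
          fix x
          have "(\<Sum>l'\<in>L. (if l' = l then 1 else 0) x * l' x) = (\<Sum>l'\<in>{l}. (if l' = l then 1 else 0) x * l' x)"
            by (rule sum.mono_neutral_right) (use l assms(3) in \<open>auto simp: zero_fun_apply\<close>)
          then show "l x = (\<Sum>l'\<in>L. (if l' = l then 1 else 0) x * l' x)"
            by (simp add: one_fun_apply)
        qed
      qed
      then show ?thesis using x(3) y[OF l1] by simp
    qed
    ultimately have "\<forall>v\<in>I. y v = 0" using trivial by blast
    then show False using x(1,2) by (simp add: y_def)
  qed
  then obtain M where M: "\<forall>f\<in>forms I M. (M, f) \<in> ?G"
    unfolding misses_all_degrees_def by blast
  have "forms I (Suc M) \<subseteq> {f. (Suc M, f) \<in> ?G}"
  proof (rule forms_subsetI[OF graded_ideal_subspace[OF G]])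
    fix vs assume vs: "set vs \<subseteq> I" "length vs = Suc M"
    then obtain u us where us: "vs = [u] @ us" by (cases vs) auto
    have "word_fun us \<in> forms I M" "word_fun [u] \<in> forms I 1"
      using word_fun_in_forms[of us I] word_fun_in_forms[of "[u]" I] vs us by auto
    then have "(1 + M, word_fun [u] * word_fun us) \<in> ?G"
      using graded_idealD(4)[OF G] M by blast
    then show "word_fun vs \<in> {f. (Suc M, f) \<in> ?G}" by (simp add: us flip: word_fun_append)
  qed
  then have *: "\<forall>f\<in>forms I (Suc M). (Suc M, f) \<in> ?G" by blast
  show ?thesis
  proof (rule that[of M], rule ballI)
    fix f assume "f \<in> forms I (Suc M)"
    then have "(Suc M, f) \<in> ?G" using * by blast
    then obtain h where "\<forall>l\<in>L. h l \<in> (if 1 \<le> Suc M then forms I (Suc M - 1) else {0})"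
      "\<forall>x\<in>X. f x = (\<Sum>l\<in>L. h l x * l x)" by (rule combinations_onE)
    then show "\<exists>h. (\<forall>l\<in>L. h l \<in> forms I M) \<and> (\<forall>x\<in>X. f x = (\<Sum>l\<in>L. h l x * l x))"
      by (intro exI[of _ h]) simp
  qed
qed

text \<open>
  Products of a monomial in the members of \<open>L\<close> and of a word of length at most \<open>M\<close>. Bounding each
  exponent by \<open>m\<close>, rather than their sum, keeps the number of exponents a power of \<open>m + 1\<close>.
\<close>

definition product_basis ::
    "'v set \<Rightarrow> (('v \<Rightarrow> complex) \<Rightarrow> complex) set \<Rightarrow> nat \<Rightarrow> nat \<Rightarrow> (('v \<Rightarrow> complex) \<Rightarrow> complex) set" where
  "product_basis I L M m =
     (\<lambda>(a, w). (\<Prod>l\<in>L. l ^ a l) * w) ` ((L \<rightarrow>\<^sub>E {..m}) \<times> {word_fun vs | vs. set vs \<subseteq> I \<and> length vs \<le> M})"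

lemma product_basis_card:
  assumes "finite I" "finite L"
  shows "finite (product_basis I L M m)"
    "card (product_basis I L M m) \<le> Suc m ^ card L * card {word_fun vs | vs. set vs \<subseteq> I \<and> length vs \<le> M}"
proof -
  let ?W = "{word_fun vs | vs. set vs \<subseteq> I \<and> length vs \<le> M}"
  have W: "finite ?W" by (rule finite_words_le[OF assms(1)])
  have P: "finite (L \<rightarrow>\<^sub>E {..m})" by (rule finite_PiE) (use assms in auto)
  show "finite (product_basis I L M m)"
    unfolding product_basis_def by (intro finite_imageI finite_cartesian_product P W)
  have "card (product_basis I L M m) \<le> card ((L \<rightarrow>\<^sub>E {..m}) \<times> ?W)"
    unfolding product_basis_def by (intro card_image_le finite_cartesian_product P W)
  also have "\<dots> = Suc m ^ card L * card ?W"
    using assms(2) by (simp add: card_cartesian_product card_PiE)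
  finally show "card (product_basis I L M m) \<le> Suc m ^ card L * card ?W" .
qed

lemma product_basis_mult:
  assumes "finite L" "l \<in> L" "g \<in> fs.span (product_basis I L M m)"
  shows "l * g \<in> fs.span (product_basis I L M (Suc m))"
proof (rule span_mult[of l "{l}" g "product_basis I L M m"])
  show "l \<in> fs.span {l}" by (simp add: fs.span_base)
  show "g \<in> fs.span (product_basis I L M m)" by (rule assms(3))
  fix l' b assume "l' \<in> {l}" "b \<in> product_basis I L M m"
  then obtain a vs where *: "l' = l" "b = (\<Prod>k\<in>L. k ^ a k) * word_fun vs" "a \<in> L \<rightarrow>\<^sub>E {..m}"
    "set vs \<subseteq> I" "length vs \<le> M"
    by (auto simp: product_basis_def)
  define a' where "a' = a(l := Suc (a l))"
  have "(\<Prod>k\<in>L. k ^ a' k) = l * (\<Prod>k\<in>L. k ^ a k)"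
  proof -
    have "(\<Prod>k\<in>L - {l}. k ^ a' k) = (\<Prod>k\<in>L - {l}. k ^ a k)"
      by (rule prod.cong) (auto simp: a'_def)
    then show ?thesis
      unfolding prod.remove[OF assms(1,2)] by (simp add: a'_def mult.assoc)
  qed
  then have "l' * b = (\<Prod>k\<in>L. k ^ a' k) * word_fun vs"
    by (simp add: * mult.assoc)
  moreover have "a' \<in> L \<rightarrow>\<^sub>E {..Suc m}"
  proof (rule PiE_I)
    fix k assume "k \<in> L"
    then have "a k \<le> m" using *(3) by (auto dest: PiE_mem)
    then show "a' k \<in> {..Suc m}" by (auto simp: a'_def)
  next
    fix k assume "k \<notin> L"
    then show "a' k = undefined" using *(3) assms(2) by (auto simp: a'_def PiE_def extensional_def)
  qed
  ultimately have "l' * b \<in> product_basis I L M (Suc m)"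
    unfolding product_basis_def using *(4,5) by (intro image_eqI[of _ _ "(a', word_fun vs)"]) auto
  then show "l' * b \<in> fs.span (product_basis I L M (Suc m))" by (rule fs.span_base)
qed

lemma word_in_product_basis:
  assumes "set vs \<subseteq> I" "length vs \<le> M" shows "word_fun vs \<in> product_basis I L M m"
  unfolding product_basis_def
proof (rule image_eqI[of _ _ "(\<lambda>l\<in>L. 0, word_fun vs)"])
  have "(\<Prod>l\<in>L. l ^ (\<lambda>l\<in>L. 0) l) = 1" by (rule prod.neutral) simp
  then show "word_fun vs = (case (\<lambda>l\<in>L. 0, word_fun vs) of (a, w) \<Rightarrow> (\<Prod>l\<in>L. l ^ a l) * w)"
    by simp
qed (use assms in auto)

text \<open>
  Noether normalization: on \<open>X\<close>, polynomial functions form a module over the polynomials in the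
  members of \<open>L\<close> that is generated by the words of length at most \<open>M\<close>. A longer word is
  rewritten by applying the hypothesis to its first \<open>M + 1\<close> letters, which produces factors in
  \<open>L\<close> and lowers the degree of the rest.
\<close>

lemma cone_functions_spanned:
  assumes L: "finite L"
    and M: "\<forall>f\<in>forms I (Suc M). \<exists>h. (\<forall>l\<in>L. h l \<in> forms I M) \<and>
      (\<forall>x\<in>X. f x = (\<Sum>l\<in>L. h l x * l x))"
  shows "f \<in> polyfuns_le I m \<Longrightarrow> \<exists>g\<in>fs.span (product_basis I L M m). \<forall>x\<in>X. f x = g x"
proof (induction m arbitrary: f)
  have sub: "fs.subspace {f. \<exists>g\<in>fs.span B. \<forall>x\<in>X. f x = g x}" for B :: "(('a \<Rightarrow> complex) \<Rightarrow> complex) set"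
  proof (rule fs.subspaceI)
    show "0 \<in> {f. \<exists>g\<in>fs.span B. \<forall>x\<in>X. f x = g x}"
      using fs.span_zero[of B] by blast
  next
    fix f f' assume "f \<in> {f. \<exists>g\<in>fs.span B. \<forall>x\<in>X. f x = g x}"
      "f' \<in> {f. \<exists>g\<in>fs.span B. \<forall>x\<in>X. f x = g x}"
    then obtain g g' where "g \<in> fs.span B" "\<forall>x\<in>X. f x = g x" "g' \<in> fs.span B" "\<forall>x\<in>X. f' x = g' x"
      by blast
    then show "f + f' \<in> {f. \<exists>g\<in>fs.span B. \<forall>x\<in>X. f x = g x}"
      by (intro CollectI bexI[of _ "g + g'"]) (auto simp: plus_fun_apply fs.span_add)
  next
    fix c f assume "f \<in> {f. \<exists>g\<in>fs.span B. \<forall>x\<in>X. f x = g x}"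
    then obtain g where "g \<in> fs.span B" "\<forall>x\<in>X. f x = g x" by blast
    then show "fscale c f \<in> {f. \<exists>g\<in>fs.span B. \<forall>x\<in>X. f x = g x}"
      by (intro CollectI bexI[of _ "fscale c g"]) (auto simp: fscale_apply fs.span_scale)
  qed
  have reduce: "polyfuns_le I m \<subseteq> {f. \<exists>g\<in>fs.span B. \<forall>x\<in>X. f x = g x}"
    if "\<And>vs. set vs \<subseteq> I \<Longrightarrow> length vs \<le> m \<Longrightarrow> \<exists>g\<in>fs.span B. \<forall>x\<in>X. word_fun vs x = g x" for m B
    unfolding polyfuns_le_def by (rule fs.span_minimal[OF _ sub]) (use that in blast)
  have short: "\<exists>g\<in>fs.span (product_basis I L M m). \<forall>x\<in>X. word_fun vs x = g x"
    if "set vs \<subseteq> I" "length vs \<le> M" for vs m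
    using fs.span_base[OF word_in_product_basis[OF that]] by blast
  {
    case 0
    have "polyfuns_le I 0 \<subseteq> {f. \<exists>g\<in>fs.span (product_basis I L M 0). \<forall>x\<in>X. f x = g x}"
      by (rule reduce, rule short) auto
    then show ?case using 0 by blast
  next
    case (Suc m)
    have "polyfuns_le I (Suc m) \<subseteq> {f. \<exists>g\<in>fs.span (product_basis I L M (Suc m)). \<forall>x\<in>X. f x = g x}"
    proof (rule reduce)
      fix vs assume vs: "set vs \<subseteq> I" "length vs \<le> Suc m"
      show "\<exists>g\<in>fs.span (product_basis I L M (Suc m)). \<forall>x\<in>X. word_fun vs x = g x"
      proof (cases "length vs \<le> M")
        case True
        then show ?thesis using short vs by blast
      next
        case False
        let ?u = "take (Suc M) vs" and ?w = "drop (Suc M) vs"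
        have u: "word_fun ?u \<in> forms I (Suc M)"
          using word_fun_in_forms[of ?u I] set_take_subset[of "Suc M" vs] vs False by simp
        have w: "word_fun ?w \<in> forms I (length vs - Suc M)"
          using word_fun_in_forms[of ?w I] set_drop_subset[of "Suc M" vs] vs False by simp
        obtain h where h: "\<forall>l\<in>L. h l \<in> forms I M" "\<forall>x\<in>X. word_fun ?u x = (\<Sum>l\<in>L. h l x * l x)"
          using M u by blast
        have "\<exists>g. g \<in> fs.span (product_basis I L M m) \<and> (\<forall>x\<in>X. (h l * word_fun ?w) x = g x)"
          if l: "l \<in> L" for l
        proof -
          have "h l * word_fun ?w \<in> forms I (M + (length vs - Suc M))"
            using forms_mult[OF bspec[OF h(1) l] w] .
          moreover have "M + (length vs - Suc M) \<le> m" using False vs by simp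
          ultimately have "h l * word_fun ?w \<in> polyfuns_le I m"
            using forms_subset_polyfuns_le polyfuns_le_mono by blast
          then show ?thesis using Suc.IH by blast
        qed
        then obtain g where g: "\<And>l. l \<in> L \<Longrightarrow> g l \<in> fs.span (product_basis I L M m)"
            "\<And>l x. l \<in> L \<Longrightarrow> x \<in> X \<Longrightarrow> (h l * word_fun ?w) x = g l x"
          by metis
        have "(\<Sum>l\<in>L. l * g l) \<in> fs.span (product_basis I L M (Suc m))"
          by (intro fs.span_sum product_basis_mult[OF L] g)
        moreover have "word_fun vs x = (\<Sum>l\<in>L. l * g l) x" if x: "x \<in> X" for x
        proof -
          have "word_fun vs x = word_fun ?u x * word_fun ?w x"
            by (metis append_take_drop_id times_fun_apply word_fun_append)
          also have "\<dots> = (\<Sum>l\<in>L. l x * (h l * word_fun ?w) x)"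
            using h(2) x by (simp add: sum_distrib_left times_fun_apply mult_ac)
          also have "\<dots> = (\<Sum>l\<in>L. l * g l) x"
            using g(2)[OF _ x] by (simp add: sum_fun_apply times_fun_apply)
          finally show ?thesis .
        qed
        ultimately show ?thesis by blast
      qed
    qed
    then show ?case using Suc.prems by blast
  }
qed

section \<open>Chains and the number of cutting forms\<close>

text \<open>
  Exponents of the functions attached to the steps of a chain. The last entry belongs to the
  topmost step, so that removing it shortens the chain from above.
\<close>

definition exponents :: "nat \<Rightarrow> nat \<Rightarrow> nat list set" where
  "exponents k m = {a. set a \<subseteq> {..m} \<and> length a = k}"

definition power_product :: "(nat \<Rightarrow> 'a \<Rightarrow> complex) \<Rightarrow> nat list \<Rightarrow> 'a \<Rightarrow> complex" where
  "power_product f a = (\<Prod>i<length a. f i ^ (a ! i))"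

lemma finite_exponents: "finite (exponents k m)"
  unfolding exponents_def by (rule finite_lists_length_eq) simp

lemma card_exponents: "card (exponents k m) = Suc m ^ k"
  unfolding exponents_def by (simp add: card_lists_length_eq)

lemma exponents_Suc: "exponents (Suc k) m = (\<lambda>(a, j). a @ [j]) ` (exponents k m \<times> {..m})"
proof (intro set_eqI iffI)
  fix b assume b: "b \<in> exponents (Suc k) m"
  then obtain a j where "b = a @ [j]" by (cases b rule: rev_exhaust) (auto simp: exponents_def)
  then show "b \<in> (\<lambda>(a, j). a @ [j]) ` (exponents k m \<times> {..m})"
    using b by (intro image_eqI[of _ _ "(a, j)"]) (auto simp: exponents_def)
qed (auto simp: exponents_def)

lemma power_product_snoc:
  "length a = k \<Longrightarrow> power_product f (a @ [j]) x = power_product f a x * f k x ^ j"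
  by (simp add: power_product_def prod_fun_apply power_fun_apply nth_append times_fun_apply)

text \<open>
  Order a polynomial relation by powers of the last function \<open>f k\<close>, which vanishes on \<open>Y k\<close>
  but not on \<open>Y (Suc k)\<close>. As \<open>Y (Suc k)\<close> is irreducible, powers of \<open>f k\<close> can be cancelled on it.
  Restricting what remains to \<open>Y k\<close> leaves the lowest coefficient, a relation between the
  other functions on \<open>Y k\<close>, which is trivial by induction.
\<close>

lemma chain_algebraically_independent:
  assumes "\<And>i. i \<le> k \<Longrightarrow> irreducible_closed I (Y i)" "\<And>i. i < k \<Longrightarrow> Y i \<subseteq> Y (Suc i)"
    and "\<And>i. i < k \<Longrightarrow> f i \<in> polyfuns I" "\<And>i. i < k \<Longrightarrow> \<forall>y\<in>Y i. f i y = 0"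
    and "\<And>i. i < k \<Longrightarrow> \<exists>y\<in>Y (Suc i). f i y \<noteq> 0"
    and "\<forall>y\<in>Y k. (\<Sum>a\<in>exponents k m. c a * power_product f a y) = 0"
  shows "\<forall>a\<in>exponents k m. c a = 0"
  using assms
proof (induction k arbitrary: c)
  case 0
  then obtain y where "y \<in> Y 0" by (auto simp: irreducible_closed_def)
  moreover have "exponents 0 m = {[]}" by (auto simp: exponents_def)
  ultimately show ?case using bspec[OF 0(6)] by (simp add: power_product_def one_fun_apply)
next
  case (Suc k)
  define q where "q j = (\<Sum>a\<in>exponents k m. fscale (c (a @ [j])) (power_product f a))" for j
  have q_apply: "q j y = (\<Sum>a\<in>exponents k m. c (a @ [j]) * power_product f a y)" for j y
    by (simp add: q_def sum_fun_apply fscale_apply)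
  have pp: "power_product f a \<in> polyfuns I" if "a \<in> exponents k m" for a
    unfolding power_product_def
    by (intro prod_in_polyfuns power_in_polyfuns Suc.prems(3)) (use that in \<open>auto simp: exponents_def\<close>)
  have q: "q j \<in> polyfuns I" for j
    unfolding q_def
    by (intro fs.subspace_sum[OF subspace_polyfuns] fs.subspace_scale[OF subspace_polyfuns] pp)
  have fk: "f k \<in> polyfuns I" by (rule Suc.prems(3)) simp
  have zero: "(\<Sum>j\<le>m. f k y ^ j * q j y) = 0" if y: "y \<in> Y (Suc k)" for y
  proof -
    have "(\<Sum>j\<le>m. f k y ^ j * q j y)
        = (\<Sum>j\<le>m. \<Sum>a\<in>exponents k m. c (a @ [j]) * power_product f (a @ [j]) y)"
      unfolding q_apply sum_distrib_left
      by (intro sum.cong refl) (auto simp: power_product_snoc exponents_def)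
    also have "\<dots> = (\<Sum>(a, j)\<in>exponents k m \<times> {..m}. c (a @ [j]) * power_product f (a @ [j]) y)"
      by (subst sum.swap) (simp add: sum.cartesian_product)
    also have "\<dots> = (\<Sum>a\<in>exponents (Suc k) m. c a * power_product f a y)"
      unfolding exponents_Suc by (subst sum.reindex) (auto simp: inj_on_def case_prod_beta)
    finally show ?thesis using Suc.prems(6) y by simp
  qed
  have coeff: "j \<le> m \<Longrightarrow> \<forall>a\<in>exponents k m. c (a @ [j]) = 0" for j
  proof (induction j rule: less_induct)
    case (less j)
    have q0: "q i y = 0" if "i < j" for i y
      using less.IH[OF that] less.prems that by (simp add: q_apply)
    define r where "r = (\<Sum>i\<in>{j..m}. f k ^ (i - j) * q i)"
    have r: "r \<in> polyfuns I"
      unfolding r_def by (intro fs.subspace_sum[OF subspace_polyfuns] polyfuns_mult power_in_polyfuns fk q)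
    have "(f k ^ j) y * r y = 0" if y: "y \<in> Y (Suc k)" for y
    proof -
      have "(f k ^ j) y * r y = (\<Sum>i\<in>{j..m}. f k y ^ i * q i y)"
        unfolding r_def sum_fun_apply sum_distrib_left
        by (rule sum.cong) (auto simp: times_fun_apply power_fun_apply simp flip: power_add mult.assoc)
      also have "\<dots> = (\<Sum>i\<le>m. f k y ^ i * q i y)"
        by (rule sum.mono_neutral_left) (use q0 in auto)
      finally show ?thesis using zero[OF y] by simp
    qed
    moreover have "\<exists>y\<in>Y (Suc k). (f k ^ j) y \<noteq> 0"
      using Suc.prems(5)[of k] by (auto simp: power_fun_apply)
    ultimately have r0: "\<forall>y\<in>Y (Suc k). r y = 0"
      using irreducible_closed_prime[OF Suc.prems(1)[of "Suc k"] power_in_polyfuns[OF fk, of j] r] by blast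
    have "q j y = 0" if y: "y \<in> Y k" for y
    proof -
      have "f k y = 0" using Suc.prems(4)[of k] y by simp
      then have "r y = (\<Sum>i\<in>{j}. 0 ^ (i - j) * q i y)"
        unfolding r_def sum_fun_apply times_fun_apply power_fun_apply
        by (intro sum.mono_neutral_cong_right) (use less.prems in auto)
      then show ?thesis using r0 y Suc.prems(2)[of k] by auto
    qed
    then show ?case
      using Suc.prems by (intro Suc.IH[of "\<lambda>a. c (a @ [j])"]) (auto simp: q_apply)
  qed
  then show ?case unfolding exponents_Suc by auto
qed

text \<open>
  Suppose that fewer than \<open>k\<close> linear forms cut \<open>X\<close> down to the origin. The \<open>(m + 1) ^ k\<close>
  monomials with exponents at most \<open>m\<close> in \<open>k\<close> algebraically independent functions lie in a
  space whose dimension, by \<open>cone_functions_spanned\<close>, grows at most like the power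
  \<open>m ^ card L\<close>. For large \<open>m\<close> this is impossible.
\<close>

theorem chain_length_le_cutting_forms:
  assumes I: "finite I" and X: "closed_cone I X"
    and Y: "\<And>i. i \<le> k \<Longrightarrow> irreducible_closed I (Y i)" "\<And>i. i \<le> k \<Longrightarrow> Y i \<subseteq> X"
      "\<And>i. i < k \<Longrightarrow> Y i \<subset> Y (Suc i)"
    and L: "finite L" "L \<subseteq> forms I 1" "card L < k"
  shows "\<exists>x\<in>X. (\<forall>l\<in>L. l x = 0) \<and> (\<exists>v\<in>I. x v \<noteq> 0)"
proof (rule ccontr)
  assume "\<not> ?thesis"
  then have "\<And>x. x \<in> X \<Longrightarrow> \<forall>l\<in>L. l x = 0 \<Longrightarrow> \<forall>v\<in>I. x v = 0" by blast
  then obtain M where M: "\<forall>f\<in>forms I (Suc M). \<exists>h. (\<forall>l\<in>L. h l \<in> forms I M) \<and>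
      (\<forall>x\<in>X. f x = (\<Sum>l\<in>L. h l x * l x))"
    by (rule cone_forms_combination[OF I X L(1,2)])
  have "\<exists>f. f \<in> polyfuns I \<and> (\<forall>y\<in>Y i. f y = 0) \<and> (\<exists>y\<in>Y (Suc i). f y \<noteq> 0)" if i: "i < k" for i
  proof -
    obtain y where y: "y \<in> Y (Suc i)" "y \<notin> Y i" using Y(3)[OF i] by blast
    have c: "zariski_closed I (Y i)" "zariski_closed I (Y (Suc i))"
      using Y(1)[of i] Y(1)[of "Suc i"] i by (auto simp: irreducible_closed_def)
    have "y \<in> affine_space I" using zariski_closed_subset[OF c(2)] y by blast
    then show ?thesis using zariski_closed_separate[OF c(1) _ y(2)] y(1) by metis
  qed
  then obtain f where f: "\<And>i. i < k \<Longrightarrow> f i \<in> polyfuns I" "\<And>i. i < k \<Longrightarrow> \<forall>y\<in>Y i. f i y = 0"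
      "\<And>i. i < k \<Longrightarrow> \<exists>y\<in>Y (Suc i). f i y \<noteq> 0"
    by metis
  have "\<exists>d. f i \<in> polyfuns_le I d" if "i < k" for i
    using polyfuns_degree_bound[OF f(1)[OF that]] by blast
  then obtain d where d: "\<And>i. i < k \<Longrightarrow> f i \<in> polyfuns_le I (d i)" by metis
  define D where "D = (\<Sum>i<k. d i)"
  have fD: "f i \<in> polyfuns_le I D" if "i < k" for i
  proof -
    have "d i \<le> D" unfolding D_def by (rule member_le_sum) (use that in auto)
    then show ?thesis using d[OF that] polyfuns_le_mono by blast
  qed
  define W where "W = card {word_fun vs | vs. set vs \<subseteq> I \<and> length vs \<le> M}"
  have bound: "Suc m ^ k \<le> Suc (k * (m * D)) ^ card L * W" for m
  proof (rule ccontr)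
    assume less: "\<not> ?thesis"
    let ?B = "product_basis I L M (k * (m * D))"
    have "\<exists>g. g \<in> fs.span ?B \<and> (\<forall>x\<in>X. power_product f a x = g x)" if a: "a \<in> exponents k m" for a
    proof -
      have "power_product f (a) \<in> polyfuns_le I (k * (m * D))"
      proof -
        have "(\<Prod>i<j. f i ^ (a ! i)) \<in> polyfuns_le I (j * (m * D))" if "j \<le> k" for j
          using that
        proof (induction j)
          case 0
          then show ?case using one_in_forms[of I] forms_subset_polyfuns_le[of I 0] by auto
        next
          case (Suc j)
          have "a ! j \<in> set a" using a Suc.prems by (auto simp: exponents_def)
          then have "a ! j \<le> m" using a by (auto simp: exponents_def)
          then have "a ! j * D \<le> m * D" by simp
          then have "f j ^ (a ! j) \<in> polyfuns_le I (m * D)"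
            using power_in_polyfuns_le[OF fD, of j "a ! j"] Suc.prems
              subsetD[OF polyfuns_le_mono[of "a ! j * D" "m * D" I]] by simp
          then show ?case
            using polyfuns_le_mult[OF Suc.IH] Suc.prems by (simp add: add.commute)
        qed
        then show ?thesis unfolding power_product_def using a by (simp add: exponents_def)
      qed
      then show ?thesis using cone_functions_spanned[OF L(1) M] by blast
    qed
    then obtain g where g: "\<And>a. a \<in> exponents k m \<Longrightarrow> g a \<in> fs.span ?B"
        "\<And>a x. a \<in> exponents k m \<Longrightarrow> x \<in> X \<Longrightarrow> power_product f a x = g a x"
      by metis
    have "card ?B < card (exponents k m)"
      using less product_basis_card(2)[OF I L(1), of M "k * (m * D)"]
      by (simp add: W_def card_exponents)
    then obtain c where c: "\<exists>a\<in>exponents k m. c a \<noteq> 0" "(\<Sum>a\<in>exponents k m. fscale (c a) (g a)) = 0"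
      by (rule span_linear_relation[where h = g,
            OF product_basis_card(1)[OF I L(1)] finite_exponents _ g(1)])
    have "(\<Sum>a\<in>exponents k m. c a * power_product f a y) = 0" if y: "y \<in> Y k" for y
    proof -
      have "y \<in> X" using Y(2)[of k] y by blast
      then have "(\<Sum>a\<in>exponents k m. c a * power_product f a y) = (\<Sum>a\<in>exponents k m. fscale (c a) (g a)) y"
        using g(2) by (simp add: sum_fun_apply fscale_apply)
      then show ?thesis using c(2) by (simp add: zero_fun_apply)
    qed
    then have "\<forall>a\<in>exponents k m. c a = 0"
      using Y(1) f psubset_imp_subset[OF Y(3)]
      by (intro chain_algebraically_independent[of k I Y f]) blast+
    then show False using c(1) by blast
  qed
  define r where "r = card L"
  \<comment> \<open>The dimension bound is at most \<open>Suc m ^ r * (Suc (k * D) ^ r * W)\<close>; make \<open>m\<close> the last factor.\<close>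
  define m where "m = Suc (k * D) ^ r * W"
  have "Suc (k * (m * D)) \<le> Suc (k * D) * Suc m" by (simp add: algebra_simps)
  then have "Suc (k * (m * D)) ^ r * W \<le> (Suc (k * D) * Suc m) ^ r * W"
    by (intro mult_le_mono1 power_mono zero_le)
  also have "\<dots> = Suc m ^ r * m" by (simp only: m_def power_mult_distrib mult_ac)
  also have "\<dots> < Suc m ^ Suc r" by simp
  also have "\<dots> \<le> Suc m ^ k" by (rule power_increasing) (use L(3) in \<open>auto simp: r_def\<close>)
  finally show False using bound[of m] by (simp add: r_def)
qed

section \<open>Long chains in cones that resist cutting\<close>

lemma irreducible_closedD:
  assumes "irreducible_closed I Y" shows "zariski_closed I Y" "Y \<noteq> {}"
  using assms by (simp_all add: irreducible_closed_def)

lemma wf_closed_psubset: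
  assumes "finite I"
  shows "wf {(A, B). zariski_closed I A \<and> zariski_closed I B \<and> A \<subset> B}"
  unfolding wf_iff_no_infinite_down_chain
proof
  assume "\<exists>Z. \<forall>j. (Z (Suc j), Z j) \<in> {(A, B). zariski_closed I A \<and> zariski_closed I B \<and> A \<subset> B}"
  then obtain Z where "\<forall>j. (Z (Suc j), Z j) \<in> {(A, B). zariski_closed I A \<and> zariski_closed I B \<and> A \<subset> B}" ..
  then have "\<And>j. zariski_closed I (Z j)" "\<And>j. Z (Suc j) \<subset> Z j" by auto
  then show False by (rule no_descending_closed_chain[OF assms])
qed

text \<open>
  Noetherian induction: a nonempty closed set that is not irreducible is the union of two smaller
  closed sets.
\<close>

lemma irreducible_decomposition:
  assumes "finite I" "zariski_closed I Z"
  shows "\<exists>F. finite F \<and> (\<forall>C\<in>F. irreducible_closed I C) \<and> Z = \<Union>F"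
  using assms(2)
proof (induction Z rule: wf_induct_rule[OF wf_closed_psubset[OF assms(1)]])
  case (1 Z)
  show ?case
  proof (cases "Z = {} \<or> irreducible_closed I Z")
    case True
    then show ?thesis
    proof
      assume "Z = {}" then show ?thesis by (intro exI[of _ "{}"]) simp
    next
      assume "irreducible_closed I Z" then show ?thesis by (intro exI[of _ "{Z}"]) simp
    qed
  next
    case False
    then obtain A B where AB: "zariski_closed I A" "zariski_closed I B" "Z = A \<union> B" "Z \<noteq> A" "Z \<noteq> B"
      using 1(2) unfolding irreducible_closed_def by blast
    then have "A \<subset> Z" "B \<subset> Z" by blast+
    obtain F where F: "finite F" "\<forall>C\<in>F. irreducible_closed I C" "A = \<Union>F"
      using 1(1)[of A] AB(1) 1(2) \<open>A \<subset> Z\<close> by auto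
    obtain G where G: "finite G" "\<forall>C\<in>G. irreducible_closed I C" "B = \<Union>G"
      using 1(1)[of B] AB(2) 1(2) \<open>B \<subset> Z\<close> by auto
    show ?thesis
      by (intro exI[of _ "F \<union> G"]) (use F G AB(3) in auto)
  qed
qed

lemma zariski_closed_empty: "zariski_closed I {}"
  using zariski_closed_zeros[of "{\<lambda>_. 1}" I] const_in_polyfuns[of 1 I] by simp

lemma zariski_closed_Union: "finite F \<Longrightarrow> \<forall>C\<in>F. zariski_closed I C \<Longrightarrow> zariski_closed I (\<Union>F)"
  by (induction F rule: finite_induct) (auto simp: zariski_closed_empty zariski_closed_Un)

lemma irreducible_subset_component:
  assumes "finite F" "irreducible_closed I Y" "\<forall>C\<in>F. zariski_closed I C" "Y \<subseteq> \<Union>F"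
  shows "\<exists>C\<in>F. Y \<subseteq> C"
  using assms(1,3,4)
proof (induction F rule: finite_induct)
  case empty
  then show ?case using assms(2) by (simp add: irreducible_closed_def)
next
  case (insert C F)
  have Y: "zariski_closed I Y" using assms(2) by (simp add: irreducible_closed_def)
  have "zariski_closed I (Y \<inter> C)" "zariski_closed I (Y \<inter> \<Union>F)"
    using insert.prems insert.hyps by (auto intro!: zariski_closed_Int Y zariski_closed_Union)
  moreover have "Y = (Y \<inter> C) \<union> (Y \<inter> \<Union>F)" using insert.prems by blast
  ultimately have "Y = Y \<inter> C \<or> Y = Y \<inter> \<Union>F"
    using assms(2) unfolding irreducible_closed_def by blast
  then show ?case
  proof
    assume "Y = Y \<inter> C" then show ?thesis by blast
  next
    assume "Y = Y \<inter> \<Union>F"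
    then have "Y \<subseteq> \<Union>F" by blast
    then show ?thesis using insert.IH insert.prems by blast
  qed
qed

text \<open>
  Points are added one at a time. If the form found so far vanishes at the new point \<open>p\<close>, add a
  multiple \<open>t\<close> of a coordinate that does not; each point excludes at most one value of \<open>t\<close>.
\<close>

lemma exists_nonvanishing_linear_form:
  assumes "finite P" "\<forall>p\<in>P. \<exists>v\<in>I. p v \<noteq> 0"
  shows "\<exists>l\<in>forms I 1. \<forall>p\<in>P. l p \<noteq> 0"
  using assms
proof (induction P rule: finite_induct)
  case empty
  then show ?case using fs.subspace_0[OF subspace_forms] by blast
next
  case (insert p P)
  then obtain l where l: "l \<in> forms I 1" "\<forall>q\<in>P. l q \<noteq> 0" by auto
  obtain v where v: "v \<in> I" "p v \<noteq> 0" using insert.prems by auto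
  have "finite ((\<lambda>q. - l q / q v) ` insert p P)" using insert.hyps by simp
  then obtain t where t: "t \<notin> (\<lambda>q. - l q / q v) ` insert p P"
    using ex_new_if_finite[OF infinite_UNIV_char_0] by blast
  show ?case
  proof (cases "l p = 0")
    case False
    then show ?thesis using l by blast
  next
    case True
    let ?l = "l + fscale t (\<lambda>x. x v)"
    have "?l \<in> forms I 1"
      by (intro fs.subspace_add[OF subspace_forms] fs.subspace_scale[OF subspace_forms]
          coord_in_forms l v)
    moreover have "?l q \<noteq> 0" if q: "q \<in> insert p P" for q
    proof
      assume "?l q = 0"
      then have eq: "l q + t * q v = 0" by (simp add: plus_fun_apply fscale_apply)
      have "q v \<noteq> 0" using eq q l(2) v(2) by auto
      then have "t = - l q / q v" using eq by (simp add: field_simps eq_neg_iff_add_eq_0)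
      then show False using t q by blast
    qed
    ultimately show ?thesis by blast
  qed
qed

lemma origin_irreducible: "irreducible_closed I {\<lambda>v\<in>I. 0}"
proof -
  have "{\<lambda>v\<in>I. 0} = {x \<in> affine_space I. \<forall>f\<in>(\<lambda>v x. x v) ` I. f x = 0}"
  proof (intro set_eqI iffI)
    fix x assume "x \<in> {x \<in> affine_space I. \<forall>f\<in>(\<lambda>v x. x v) ` I. f x = 0}"
    then have "x \<in> extensional I" "\<forall>v\<in>I. x v = 0" by (auto simp: affine_space_def PiE_def)
    then have "x = (\<lambda>v\<in>I. 0)" by (intro extensionalityI[of x I]) auto
    then show "x \<in> {\<lambda>v\<in>I. 0}" by simp
  qed (auto simp: affine_space_def)
  moreover have "(\<lambda>v x. x v) ` I \<subseteq> polyfuns I" by (auto intro!: coord_in_polyfuns)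
  ultimately have "zariski_closed I {\<lambda>v\<in>I. 0}"
    using zariski_closed_zeros[of "(\<lambda>v x. x v) ` I" I] by (simp only:)
  moreover have "{\<lambda>v\<in>I. 0} = A \<or> {\<lambda>v\<in>I. 0} = B" if "{\<lambda>v\<in>I. 0} = A \<union> B"
    for A B :: "('a \<Rightarrow> complex) set"
    using that by (cases "A = {}") blast+
  ultimately show ?thesis unfolding irreducible_closed_def by blast
qed

text \<open>
  Restricted to the line, polynomial functions are polynomials in the parameter \<open>t\<close>, and these have
  no zero divisors.
\<close>

lemma line_irreducible:
  assumes x: "x \<in> affine_space I" and v: "v \<in> I" "x v \<noteq> 0"
  shows "irreducible_closed I (range (\<lambda>t. scale_point I t x))"
proof -
  let ?C = "range (\<lambda>t. scale_point I t x)"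
  let ?S = "{(\<lambda>y. y u * x w) - (\<lambda>y. y w * x u) | u w. u \<in> I \<and> w \<in> I}"
  have "?S \<subseteq> polyfuns I"
  proof
    fix f assume "f \<in> ?S"
    then obtain u w where f: "f = fscale (x w) (\<lambda>y. y u) - fscale (x u) (\<lambda>y. y w)" "u \<in> I" "w \<in> I"
      by (auto simp: fscale_def mult.commute)
    show "f \<in> polyfuns I" unfolding f(1)
      by (intro fs.subspace_diff[OF subspace_polyfuns] fs.subspace_scale[OF subspace_polyfuns]
          coord_in_polyfuns f)
  qed
  moreover have "?C = {y \<in> affine_space I. \<forall>f\<in>?S. f y = 0}"
  proof (intro set_eqI iffI)
    fix y assume "y \<in> ?C"
    then show "y \<in> {y \<in> affine_space I. \<forall>f\<in>?S. f y = 0}"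
      by (auto simp: affine_space_def scale_point_def minus_apply)
  next
    fix y assume y: "y \<in> {y \<in> affine_space I. \<forall>f\<in>?S. f y = 0}"
    have eq: "y v * x w = y w * x v" if "w \<in> I" for w
    proof -
      have "((\<lambda>y. y v * x w) - (\<lambda>y. y w * x v)) \<in> ?S" using that v by blast
      then have "((\<lambda>y. y v * x w) - (\<lambda>y. y w * x v)) y = 0" using y by blast
      then show ?thesis by (simp add: minus_apply)
    qed
    have "y = scale_point I (y v / x v) x"
    proof (rule extensionalityI[of _ I])
      show "y \<in> extensional I" using y by (auto simp: affine_space_def PiE_def)
      show "scale_point I (y v / x v) x \<in> extensional I" by (simp add: scale_point_def)
      fix w assume "w \<in> I"
      then show "y w = scale_point I (y v / x v) x w"
        using eq[of w] v by (simp add: scale_point_def field_simps)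
    qed
    then show "y \<in> ?C" by blast
  qed
  ultimately have closed: "zariski_closed I ?C" using zariski_closed_zeros[of ?S I] by (simp only:)
  have "?C = A \<or> ?C = B" if A: "zariski_closed I A" and B: "zariski_closed I B" and AB: "?C = A \<union> B" for A B
  proof (rule ccontr)
    assume "\<not> ?thesis"
    then obtain s t where st: "scale_point I s x \<notin> A" "scale_point I t x \<notin> B" using AB by blast
    have aff: "scale_point I r x \<in> affine_space I" for r by (simp add: scale_point_def affine_space_def)
    obtain f where f: "f \<in> polyfuns I" "f (scale_point I s x) \<noteq> 0" "\<forall>z\<in>A. f z = 0"
      using A aff st(1) by (rule zariski_closed_separate)
    obtain g where g: "g \<in> polyfuns I" "g (scale_point I t x) \<noteq> 0" "\<forall>z\<in>B. g z = 0"
      using B aff st(2) by (rule zariski_closed_separate)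
    obtain p where p: "\<forall>t. f (\<lambda>v. t * x v) = poly p t" by (rule polyfuns_along_line[OF f(1)])
    obtain q where q: "\<forall>t. g (\<lambda>v. t * x v) = poly q t" by (rule polyfuns_along_line[OF g(1)])
    have "poly (p * q) r = 0" for r
    proof -
      have "scale_point I r x \<in> A \<union> B" using AB by blast
      then have "f (scale_point I r x) * g (scale_point I r x) = 0" using f(3) g(3) by auto
      then show ?thesis
        using p q polyfuns_scale_point[OF f(1), of r x] polyfuns_scale_point[OF g(1), of r x] by simp
    qed
    then have "p * q = 0" by (intro poly_all_0_iff_0[THEN iffD1]) simp
    then have "p = 0 \<or> q = 0" by simp
    then show False
      using f(2) g(2) p q polyfuns_scale_point[OF f(1), of s x] polyfuns_scale_point[OF g(1), of t x]
      by auto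
  qed
  then show ?thesis using closed unfolding irreducible_closed_def by blast
qed

lemma closed_cone_Int_form:
  assumes "closed_cone I X" "l \<in> forms I 1"
  shows "closed_cone I {x \<in> X. l x = 0}"
proof -
  have "zariski_closed I {x \<in> X. \<forall>f\<in>{l}. f x = 0}"
    using assms subsetD[OF forms_subset_polyfuns] by (intro zariski_closed_Int_zeros) (auto simp: closed_cone_def)
  then show ?thesis
    using assms forms_scale_point[OF assms(2)] by (auto simp: closed_cone_def)
qed

text \<open>
  Choose a linear form \<open>l\<close> that vanishes on no component of \<open>X\<close> other than the origin. The
  part of \<open>X\<close> where \<open>l\<close> vanishes is a cone that cannot be cut down to the origin by one form fewer,
  so it contains a chain that is shorter by one. The top of this chain lies in a component of \<open>X\<close>,
  and it is smaller than that component because \<open>l\<close> vanishes on it. At the bottom of the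
  induction, a line through the origin gives a chain of length one.
\<close>

theorem chain_of_uncuttable_cone:
  assumes I: "finite I" and "closed_cone I X"
    and "\<And>L. finite L \<Longrightarrow> L \<subseteq> forms I 1 \<Longrightarrow> card L \<le> s \<Longrightarrow>
       \<exists>x\<in>X. (\<forall>l\<in>L. l x = 0) \<and> (\<exists>v\<in>I. x v \<noteq> 0)"
  shows "\<exists>Y. (\<forall>i\<le>Suc s. irreducible_closed I (Y i) \<and> Y i \<subseteq> X) \<and> (\<forall>i<Suc s. Y i \<subset> Y (Suc i))"
  using assms(2,3)
proof (induction s arbitrary: X)
  case 0
  obtain x v where x: "x \<in> X" "v \<in> I" "x v \<noteq> 0" using 0(2)[of "{}"] by auto
  have aff: "x \<in> affine_space I"
    using 0(1) x zariski_closed_subset by (auto simp: closed_cone_def)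
  let ?C = "range (\<lambda>t. scale_point I t x)"
  define Y where "Y i = (if i = 0 then {\<lambda>v\<in>I. 0} else ?C)" for i :: nat
  have C: "irreducible_closed I ?C" by (rule line_irreducible[OF aff x(2,3)])
  have sub: "?C \<subseteq> X" using 0(1) x by (auto simp: closed_cone_def)
  have o: "(\<lambda>v\<in>I. 0) = scale_point I 0 x" by (simp add: scale_point_def)
  have "(\<lambda>v\<in>I. 0) \<noteq> scale_point I 1 x"
  proof
    assume "(\<lambda>v\<in>I. 0) = scale_point I 1 x"
    then have "(\<lambda>v\<in>I. 0) v = scale_point I 1 x v" by (rule fun_cong)
    then show False using x by (simp add: scale_point_def)
  qed
  then have "{\<lambda>v\<in>I. 0} \<noteq> ?C" using rangeI[of "\<lambda>t. scale_point I t x" 1] by (metis singletonD)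
  moreover have "(\<lambda>v\<in>I. 0) \<in> ?C" unfolding o by (rule rangeI)
  ultimately have "{\<lambda>v\<in>I. 0} \<subset> ?C" by (simp only: psubset_eq insert_subset empty_subsetI simp_thms)
  moreover have "Y 0 = {\<lambda>v\<in>I. 0}" "Y (Suc 0) = ?C" by (simp_all only: Y_def if_True if_False nat.distinct refl)
  ultimately have "Y 0 \<subset> Y (Suc 0)" by (simp only:)
  moreover have "irreducible_closed I (Y i) \<and> Y i \<subseteq> X" for i
  proof (cases "i = 0")
    case True
    have "scale_point I 0 x \<in> X" by (rule subsetD[OF sub rangeI])
    then have "(\<lambda>v\<in>I. 0) \<in> X" by (simp only: o)
    then show ?thesis using True origin_irreducible by (simp add: Y_def)
  next
    case False
    then show ?thesis using C sub by (simp add: Y_def)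
  qed
  ultimately show ?case by (intro exI[of _ Y]) simp
next
  case (Suc s)
  have "zariski_closed I X" using Suc.prems(1) by (simp add: closed_cone_def)
  then obtain F where F: "finite F" "\<forall>C\<in>F. irreducible_closed I C" "X = \<Union>F"
    using irreducible_decomposition[OF I] by blast
  \<comment> \<open>the components other than the origin, and a point in each at which \<open>l\<close> is not to vanish\<close>
  define F' where "F' = {C \<in> F. \<exists>x\<in>C. \<exists>v\<in>I. x v \<noteq> 0}"
  have "\<forall>C\<in>F'. \<exists>x. x \<in> C \<and> (\<exists>v\<in>I. x v \<noteq> 0)" by (auto simp: F'_def)
  then obtain pt where pt: "\<forall>C\<in>F'. pt C \<in> C \<and> (\<exists>v\<in>I. pt C v \<noteq> 0)" by (rule bchoice[THEN exE])
  have "finite (pt ` F')" using F(1) by (simp add: F'_def)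
  then obtain l where l: "l \<in> forms I 1" "\<forall>p\<in>pt ` F'. l p \<noteq> 0"
    using exists_nonvanishing_linear_form[of "pt ` F'" I] pt by blast
  let ?X = "{x \<in> X. l x = 0}"
  have "\<exists>x\<in>?X. (\<forall>k\<in>L. k x = 0) \<and> (\<exists>v\<in>I. x v \<noteq> 0)"
    if L: "finite L" "L \<subseteq> forms I 1" "card L \<le> s" for L
  proof -
    have "card (insert l L) \<le> Suc s" using L card_insert_le_m1[of "Suc s" L l] by simp
    then show ?thesis using Suc.prems(2)[of "insert l L"] L l(1) by auto
  qed
  then obtain Y where Y: "\<forall>i\<le>Suc s. irreducible_closed I (Y i) \<and> Y i \<subseteq> ?X" "\<forall>i<Suc s. Y i \<subset> Y (Suc i)"
    using Suc.IH[OF closed_cone_Int_form[OF Suc.prems(1) l(1)]] by blast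
  have Yirr: "irreducible_closed I (Y i)" if "i \<le> Suc s" for i using Y(1) that by blast
  have "Y (Suc s) \<subseteq> \<Union>F" using Y(1) F(3) by blast
  moreover have "\<forall>C\<in>F. zariski_closed I C" using F(2) irreducible_closedD(1) by blast
  ultimately obtain C where C: "C \<in> F" "Y (Suc s) \<subseteq> C"
    using irreducible_subset_component[OF F(1) Yirr[OF order_refl]] by blast
  \<comment> \<open>A chain of positive length has at least two points in its top member.\<close>
  have "C \<in> F'"
  proof -
    have "Y s \<noteq> {}" by (rule irreducible_closedD(2)[OF Yirr]) simp
    moreover have sub: "Y s \<subset> Y (Suc s)" using Y(2) by simp
    ultimately obtain y z where yz: "y \<in> Y s" "z \<in> Y (Suc s)" "z \<notin> Y s" by blast
    then have "y \<in> C" "z \<in> C" "y \<noteq> z" using sub C(2) by auto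
    have "C \<subseteq> affine_space I"
      using F(2) C(1) irreducible_closedD(1) zariski_closed_subset by blast
    then have "y \<in> extensional I" "z \<in> extensional I"
      using \<open>y \<in> C\<close> \<open>z \<in> C\<close> by (auto simp: affine_space_def PiE_def)
    then obtain v where "v \<in> I" "y v \<noteq> z v" using \<open>y \<noteq> z\<close> extensionalityI[of y I z] by blast
    then have "y v \<noteq> 0 \<or> z v \<noteq> 0" by auto
    then show ?thesis unfolding F'_def using \<open>y \<in> C\<close> \<open>z \<in> C\<close> \<open>v \<in> I\<close> C(1) by blast
  qed
  then have "pt C \<in> C" "l (pt C) \<noteq> 0" using pt l(2) by auto
  moreover have "\<forall>y\<in>Y (Suc s). l y = 0" using Y(1) by blast
  ultimately have strict: "Y (Suc s) \<subset> C" using C(2) by blast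
  define Y' where "Y' i = (if i \<le> Suc s then Y i else C)" for i
  have "irreducible_closed I (Y' i) \<and> Y' i \<subseteq> X" for i
  proof (cases "i \<le> Suc s")
    case True
    then have "Y i \<subseteq> X" using Y(1) by blast
    then show ?thesis using True Yirr by (simp add: Y'_def)
  next
    case False
    then show ?thesis using F(2,3) C(1) by (auto simp: Y'_def)
  qed
  moreover have "Y' i \<subset> Y' (Suc i)" if "i < Suc (Suc s)" for i
  proof (cases "i = Suc s")
    case True
    then show ?thesis using strict by (simp add: Y'_def)
  next
    case False
    then show ?thesis using that Y(2) by (simp add: Y'_def)
  qed
  ultimately show ?case by blast
qed

section \<open>The two loci of a symmetric tensor\<close>

lemma closed_cone_zeros:
  assumes "\<And>f. f \<in> S \<Longrightarrow> \<exists>m. f \<in> forms I m"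
  shows "closed_cone I {x \<in> affine_space I. \<forall>f\<in>S. f x = 0}"
proof -
  have "S \<subseteq> polyfuns I" using assms forms_subset_polyfuns by blast
  then have "zariski_closed I {x \<in> affine_space I. \<forall>f\<in>S. f x = 0}" by (rule zariski_closed_zeros)
  moreover have "f (scale_point I t x) = 0" if f: "f \<in> S" "f x = 0" for f t x
  proof -
    obtain m where "f \<in> forms I m" using assms[OF f(1)] by blast
    then show ?thesis using forms_scale_point[of f I m t x] f(2) by simp
  qed
  moreover have "scale_point I t x \<in> affine_space I" for t x
    by (simp add: scale_point_def affine_space_def)
  ultimately show ?thesis unfolding closed_cone_def by blast
qed

text \<open>
  The value of the multilinear form at \<open>xs 0, \<dots>, xs (d - 2)\<close> and the basis vector \<open>i\<close>. These
  contractions define both loci: the one of the geometric rank for independent vectors, and the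
  one of the symmetric geometric rank for equal vectors.
\<close>

definition contraction ::
    "nat \<Rightarrow> nat \<Rightarrow> (nat list \<Rightarrow> complex) \<Rightarrow> nat \<Rightarrow> (nat \<Rightarrow> nat \<Rightarrow> complex) \<Rightarrow> complex" where
  "contraction n d T i xs =
     (\<Sum>is\<in>multi_indices n d. if is ! (d - 1) = i then T is * (\<Prod>k<d - 1. xs k (is ! k)) else 0)"

lemma multi_indices_nth: "is \<in> multi_indices n d \<Longrightarrow> k < d \<Longrightarrow> is ! k \<le> n"
  unfolding multi_indices_def using nth_mem by force

lemma multilinear_form_contraction:
  assumes "d \<ge> 1"
  shows "multilinear_form n d T (xs(d - 1 := y)) = (\<Sum>i\<le>n. y i * contraction n d T i xs)"
proof -
  have "(\<Sum>i\<le>n. y i * contraction n d T i xs)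
      = (\<Sum>i\<le>n. \<Sum>is\<in>multi_indices n d.
          if i = is ! (d - 1) then y i * (T is * (\<Prod>k<d - 1. xs k (is ! k))) else 0)"
    unfolding contraction_def sum_distrib_left by (intro sum.cong refl) auto
  also have "\<dots> = (\<Sum>is\<in>multi_indices n d. \<Sum>i\<le>n.
          if i = is ! (d - 1) then y i * (T is * (\<Prod>k<d - 1. xs k (is ! k))) else 0)"
    by (rule sum.swap)
  also have "\<dots> = (\<Sum>is\<in>multi_indices n d. y (is ! (d - 1)) * (T is * (\<Prod>k<d - 1. xs k (is ! k))))"
  proof (rule sum.cong[OF refl])
    fix js assume "js \<in> multi_indices n d"
    then have "js ! (d - 1) \<le> n" using multi_indices_nth assms by simp
    then show "(\<Sum>i\<le>n. if i = js ! (d - 1) then y i * (T js * (\<Prod>k<d - 1. xs k (js ! k))) else 0)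
        = y (js ! (d - 1)) * (T js * (\<Prod>k<d - 1. xs k (js ! k)))"
      by (simp add: sum.delta)
  qed
  also have "\<dots> = multilinear_form n d T (xs(d - 1 := y))"
    unfolding multilinear_form_def
  proof (rule sum.cong[OF refl])
    fix js
    have "{..<d} = insert (d - 1) {..<d - 1}" using assms by auto
    then have "(\<Prod>k<d. (xs(d - 1 := y)) k (js ! k))
        = y (js ! (d - 1)) * (\<Prod>k<d - 1. (xs(d - 1 := y)) k (js ! k))" by simp
    also have "(\<Prod>k<d - 1. (xs(d - 1 := y)) k (js ! k)) = (\<Prod>k<d - 1. xs k (js ! k))"
      by (rule prod.cong) auto
    finally show "y (js ! (d - 1)) * (T js * (\<Prod>k<d - 1. xs k (js ! k)))
        = T js * (\<Prod>k<d. (xs(d - 1 := y)) k (js ! k))" by simp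
  qed
  finally show ?thesis by simp
qed

lemma geometric_rank_zeros:
  assumes "d \<ge> 1"
  shows "(\<forall>y\<in>affine_space {..n}. multilinear_form n d T (xs(d - 1 := y)) = 0) \<longleftrightarrow>
    (\<forall>i\<le>n. contraction n d T i xs = 0)"
proof
  assume *: "\<forall>y\<in>affine_space {..n}. multilinear_form n d T (xs(d - 1 := y)) = 0"
  show "\<forall>i\<le>n. contraction n d T i xs = 0"
  proof (intro allI impI)
    fix i assume "i \<le> n"
    let ?y = "\<lambda>j\<in>{..n}. if j = i then 1 else (0::complex)"
    have "?y \<in> affine_space {..n}" by (simp add: affine_space_def)
    then have "(\<Sum>j\<le>n. ?y j * contraction n d T j xs) = 0"
      using * multilinear_form_contraction[OF assms] by metis
    also have "(\<Sum>j\<le>n. ?y j * contraction n d T j xs)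
        = (\<Sum>j\<le>n. if j = i then contraction n d T j xs else 0)"
      by (rule sum.cong) auto
    finally show "contraction n d T i xs = 0" using \<open>i \<le> n\<close> by (simp add: sum.delta')
  qed
qed (simp add: multilinear_form_contraction[OF assms] del: One_nat_def)

text \<open>
  The map \<open>g\<close> names the variable that holds entry \<open>j\<close> of the \<open>k\<close>-th vector. Distinct pairs may
  share a variable, which covers the diagonal.
\<close>

lemma contraction_in_forms:
  assumes "\<And>k i. k < d - 1 \<Longrightarrow> i \<le> n \<Longrightarrow> g k i \<in> I" "d \<ge> 1"
  shows "(\<lambda>x. contraction n d T i (\<lambda>k j. x (g k j))) \<in> forms I (d - 1)"
proof -
  have "(\<lambda>x. contraction n d T i (\<lambda>k j. x (g k j)))
      = (\<Sum>is\<in>multi_indices n d. fscale (if is ! (d - 1) = i then T is else 0)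
          (word_fun (map (\<lambda>k. g k (is ! k)) [0..<d - 1])))"
    unfolding contraction_def
    by (auto simp: fun_eq_iff sum_fun_apply fscale_apply word_fun_def o_def
        prod.list_conv_set_nth atLeast0LessThan intro!: sum.cong)
  also have "\<dots> \<in> forms I (d - 1)"
  proof (intro fs.subspace_sum[OF subspace_forms] fs.subspace_scale[OF subspace_forms])
    fix js assume js: "js \<in> multi_indices n d"
    have "set (map (\<lambda>k. g k (js ! k)) [0..<d - 1]) \<subseteq> I"
      using assms(1) multi_indices_nth[OF js] by auto
    from word_fun_in_forms[OF this]
    show "word_fun (map (\<lambda>k. g k (js ! k)) [0..<d - 1]) \<in> forms I (d - 1)" by simp
  qed
  finally show ?thesis .
qed

lemma partial_deriv_superset:
  assumes "finite K" "Poly_Mapping.keys p \<subseteq> K"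
  shows "partial_deriv v p = (\<Sum>m\<in>K. Poly_Mapping.single (m - Poly_Mapping.single v 1)
      (of_nat (Poly_Mapping.lookup m v) * Poly_Mapping.lookup p m))"
  unfolding partial_deriv_def
  by (rule sum.mono_neutral_left) (use assms in \<open>auto simp: in_keys_iff\<close>)

lemma partial_deriv_add: "partial_deriv v (p + q) = partial_deriv v p + partial_deriv v q"
proof -
  let ?K = "Poly_Mapping.keys p \<union> Poly_Mapping.keys q"
  have "Poly_Mapping.keys (p + q) \<subseteq> ?K" by (rule Poly_Mapping.keys_add)
  then show ?thesis
    by (subst (1 2 3) partial_deriv_superset[of ?K])
      (auto simp: lookup_add ring_distribs single_add sum.distrib)
qed

lemma partial_deriv_sum: "partial_deriv v (sum f A) = (\<Sum>a\<in>A. partial_deriv v (f a))"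
proof (induction A rule: infinite_finite_induct)
  case (insert a A)
  then show ?case by (simp add: partial_deriv_add)
qed (simp_all add: partial_deriv_def)

lemma partial_deriv_single:
  "partial_deriv v (Poly_Mapping.single m c)
     = Poly_Mapping.single (m - Poly_Mapping.single v 1) (of_nat (Poly_Mapping.lookup m v) * c)"
  by (subst partial_deriv_superset[of "{m}"]) auto

lemma monomial_fun_sum: "finite A \<Longrightarrow> monomial_fun (sum f A) x = (\<Prod>a\<in>A. monomial_fun (f a) x)"
  by (induction A rule: finite_induct) (auto simp: monomial_fun_add monomial_fun_0)

lemma lookup_sum: "Poly_Mapping.lookup (sum f A) v = (\<Sum>a\<in>A. Poly_Mapping.lookup (f a) v)"
  by (induction A rule: infinite_finite_induct) (auto simp: lookup_add)

text \<open>
  The product rule for a word: each occurrence of \<open>v\<close> contributes the word without it.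
\<close>

lemma word_monomial_deriv:
  fixes us :: "nat list"
  defines "M \<equiv> \<Sum>u\<leftarrow>us. Poly_Mapping.single u (1::nat)"
  shows "of_nat (Poly_Mapping.lookup M v) * monomial_fun (M - Poly_Mapping.single v 1) x
    = (\<Sum>k<length us. if us ! k = v then \<Prod>j\<in>{..<length us} - {k}. x (us ! j) else 0)"
proof -
  have M: "M = (\<Sum>j<length us. Poly_Mapping.single (us ! j) 1)"
    unfolding M_def by (subst sum_list_sum_nth) (simp add: atLeast0LessThan)
  have "Poly_Mapping.lookup M v = (\<Sum>k<length us. if us ! k = v then 1 else 0)"
    unfolding M lookup_sum by (rule sum.cong) (auto simp: lookup_single when_def)
  then have "of_nat (Poly_Mapping.lookup M v) * monomial_fun (M - Poly_Mapping.single v 1) x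
      = (\<Sum>k<length us. (if us ! k = v then 1 else 0) * monomial_fun (M - Poly_Mapping.single v 1) x)"
    by (simp only: of_nat_sum sum_distrib_right) (rule sum.cong, auto)
  also have "\<dots> = (\<Sum>k<length us. if us ! k = v then \<Prod>j\<in>{..<length us} - {k}. x (us ! j) else 0)"
  proof (rule sum.cong[OF refl])
    fix k assume k: "k \<in> {..<length us}"
    show "(if us ! k = v then 1 else 0) * monomial_fun (M - Poly_Mapping.single v 1) x
        = (if us ! k = v then \<Prod>j\<in>{..<length us} - {k}. x (us ! j) else 0)"
    proof (cases "us ! k = v")
      case True
      have "M = Poly_Mapping.single v 1 + (\<Sum>j\<in>{..<length us} - {k}. Poly_Mapping.single (us ! j) 1)"
        unfolding M using True k by (subst sum.remove[of _ k]) auto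
      then have "M - Poly_Mapping.single v 1 = (\<Sum>j\<in>{..<length us} - {k}. Poly_Mapping.single (us ! j) 1)"
        by simp
      then have "monomial_fun (M - Poly_Mapping.single v 1) x = (\<Prod>j\<in>{..<length us} - {k}. x (us ! j))"
        by (simp add: monomial_fun_sum monomial_fun_single)
      then show ?thesis using True by simp
    qed simp
  qed
  finally show ?thesis .
qed

text \<open>
  Exchanging the positions \<open>k\<close> and \<open>d - 1\<close> permutes the multi-indices and does not change the
  symmetric tensor.
\<close>

lemma symmetric_contraction:
  assumes sym: "symmetric_tensor n d T" and k: "k < d"
  shows "(\<Sum>is\<in>multi_indices n d. T is * (if is ! k = i then \<Prod>j\<in>{..<d} - {k}. x (is ! j) else 0))
    = contraction n d T i (\<lambda>_. x)"
proof -
  define \<tau> where "\<tau> = Transposition.transpose k (d - 1)"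
  define \<phi> where "\<phi> = (\<lambda>is::nat list. map (\<lambda>j. is ! \<tau> j) [0..<d])"
  have \<tau>: "\<tau> permutes {..<d}" unfolding \<tau>_def by (rule permutes_swap_id) (use k in auto)
  have \<tau>_less: "\<tau> j < d" if "j < d" for j using permutes_in_image[OF \<tau>, of j] that by simp
  have \<tau>\<tau>: "\<tau> (\<tau> j) = j" for j by (simp add: \<tau>_def)
  have \<tau>d: "\<tau> (d - 1) = k" by (simp add: \<tau>_def)
  have \<phi>_nth: "\<phi> js ! j = js ! \<tau> j" if "j < d" for js j using that by (simp add: \<phi>_def)
  have \<phi>_mem: "\<phi> js \<in> multi_indices n d" if js: "js \<in> multi_indices n d" for js
    using multi_indices_nth[OF js] \<tau>_less by (auto simp: \<phi>_def multi_indices_def)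
  have \<phi>\<phi>: "\<phi> (\<phi> js) = js" if js: "js \<in> multi_indices n d" for js
  proof (rule nth_equalityI)
    show "length (\<phi> (\<phi> js)) = length js" using js by (simp add: \<phi>_def multi_indices_def)
    fix j assume "j < length (\<phi> (\<phi> js))"
    then have "j < d" by (simp add: \<phi>_def)
    then show "\<phi> (\<phi> js) ! j = js ! j" by (simp add: \<phi>_nth \<tau>_less \<tau>\<tau>)
  qed
  have T\<phi>: "T (\<phi> js) = T js" if "js \<in> multi_indices n d" for js
    using sym \<tau> that unfolding symmetric_tensor_def \<phi>_def by blast
  have img: "\<tau> ` {..<d - 1} = {..<d} - {k}"
  proof -
    have "{..<d - 1} = {..<d} - {d - 1}" using k by auto
    moreover have "\<tau> ` ({..<d} - {d - 1}) = \<tau> ` {..<d} - \<tau> ` {d - 1}"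
      by (rule image_set_diff[OF permutes_inj[OF \<tau>]])
    ultimately show ?thesis using permutes_image[OF \<tau>] \<tau>d by simp
  qed
  have prod: "(\<Prod>j\<in>{..<d} - {k}. x (js ! j)) = (\<Prod>j<d - 1. x (\<phi> js ! j))" for js
  proof -
    have "(\<Prod>j\<in>{..<d} - {k}. x (js ! j)) = (\<Prod>j<d - 1. x (js ! \<tau> j))"
      unfolding img[symmetric]
      by (subst prod.reindex) (auto intro: inj_on_subset[OF permutes_inj[OF \<tau>]])
    also have "\<dots> = (\<Prod>j<d - 1. x (\<phi> js ! j))"
      by (rule prod.cong) (auto simp: \<phi>_nth)
    finally show ?thesis .
  qed
  show ?thesis
    unfolding contraction_def
  proof (rule sum.reindex_bij_witness[of _ \<phi> \<phi>])
    fix js assume js: "js \<in> multi_indices n d"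
    show "(if \<phi> js ! (d - 1) = i then T (\<phi> js) * (\<Prod>j<d - 1. x (\<phi> js ! j)) else 0)
        = T js * (if js ! k = i then \<Prod>j\<in>{..<d} - {k}. x (js ! j) else 0)"
    proof -
      have "\<phi> js ! (d - 1) = js ! k" using k \<phi>_nth[of "d - 1" js] \<tau>d by simp
      then show ?thesis by (simp add: T\<phi>[OF js] prod del: One_nat_def)
    qed
  qed (simp_all add: \<phi>\<phi> \<phi>_mem)
qed

text \<open>
  Differentiating \<open>T (x, \<dots>, x)\<close> by the product rule gives one summand for each of the \<open>d\<close>
  positions, and by symmetry these are equal.
\<close>

lemma poly_eval_partial_deriv_tensor_poly:
  assumes sym: "symmetric_tensor n d T"
  shows "poly_eval (partial_deriv i (tensor_poly n d T)) x
    = of_nat d * contraction n d T i (\<lambda>_. x)"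
proof -
  have "poly_eval (partial_deriv i (tensor_poly n d T)) x
      = (\<Sum>is\<in>multi_indices n d. T is *
          (of_nat (Poly_Mapping.lookup (\<Sum>u\<leftarrow>is. Poly_Mapping.single u (1::nat)) i) *
            monomial_fun ((\<Sum>u\<leftarrow>is. Poly_Mapping.single u 1) - Poly_Mapping.single i 1) x))"
    unfolding tensor_poly_def partial_deriv_sum poly_eval_sum partial_deriv_single poly_eval_single
    by (simp only: mult_ac)
  also have "\<dots> = (\<Sum>is\<in>multi_indices n d. T is *
      (\<Sum>k<d. if is ! k = i then \<Prod>j\<in>{..<d} - {k}. x (is ! j) else 0))"
    unfolding word_monomial_deriv by (rule sum.cong) (auto simp: multi_indices_def)
  also have "\<dots> = (\<Sum>k<d. \<Sum>is\<in>multi_indices n d.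
      T is * (if is ! k = i then \<Prod>j\<in>{..<d} - {k}. x (is ! j) else 0))"
    unfolding sum_distrib_left by (rule sum.swap)
  also have "\<dots> = (\<Sum>k<d. contraction n d T i (\<lambda>_. x))"
    by (rule sum.cong) (auto simp: symmetric_contraction[OF sym])
  finally show ?thesis by simp
qed

lemma zariski_dim_geI:
  assumes "\<forall>i\<le>k. irreducible_closed I (Y i) \<and> Y i \<subseteq> Z" "\<forall>i<k. Y i \<subset> Y (Suc i)"
  shows "enat k \<le> zariski_dim I Z"
  unfolding zariski_dim_def using assms by (intro Sup_upper) blast

text \<open>
  The additive form of the comparison of dimensions remains meaningful for infinite dimensions,
  for which codimension is truncated to zero.
\<close>

lemma zariski_codim_mono:
  assumes "zariski_dim J X \<le> zariski_dim I Z + enat c" "card J = card I + c"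
  shows "zariski_codim I Z \<le> zariski_codim J X"
proof (cases "zariski_dim I Z")
  case (enat s)
  then obtain t where t: "zariski_dim J X = enat t" "t \<le> s + c"
    using assms(1) by (cases "zariski_dim J X") auto
  then show ?thesis using enat assms(2) by (simp add: zariski_codim_def)
next
  case infinity
  then show ?thesis by (simp add: zariski_codim_def)
qed

theorem lemma3p4:
  fixes n d :: nat and T :: "nat list \<Rightarrow> complex"
  assumes "d \<ge> 2"
    and "symmetric_tensor n d T"
  shows "sgr n d T \<le> geometric_rank n d T"
proof -
  define J where "J = {..<d - 1} \<times> {..n}"
  define X where "X = {x \<in> affine_space J. \<forall>f\<in>(\<lambda>i x. contraction n d T i (\<lambda>k j. x (k, j))) ` {..n}. f x = 0}"
  define Z where "Z = {x \<in> affine_space {..n}. \<forall>f\<in>(\<lambda>i x. contraction n d T i (\<lambda>_ j. x j)) ` {..n}. f x = 0}"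
  have X: "closed_cone J X"
    unfolding X_def
    by (rule closed_cone_zeros) (use assms(1) in \<open>auto simp: J_def intro!: exI contraction_in_forms\<close>)
  have Z: "closed_cone {..n} Z"
    unfolding Z_def
    by (rule closed_cone_zeros) (use assms(1) in \<open>auto intro!: exI contraction_in_forms\<close>)
  have X_eq: "X = {x \<in> affine_space J. \<forall>y \<in> affine_space {..n}.
      multilinear_form n d T ((curry x)(d - 1 := y)) = 0}"
    unfolding X_def using assms(1) by (subst geometric_rank_zeros) (auto simp: curry_def)
  have Z_eq: "Z = {x \<in> affine_space {..n}.
      \<forall>i \<le> n. poly_eval (partial_deriv i (tensor_poly n d T)) x = 0}"
    unfolding Z_def poly_eval_partial_deriv_tensor_poly[OF assms(2)] using assms(1) by auto
  define c where "c = (d - 2) * Suc n"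
  have cut: "\<exists>x\<in>Z. (\<forall>l\<in>L. l x = 0) \<and> (\<exists>v\<in>{..n}. x v \<noteq> 0)"
    if Y: "\<And>i. i \<le> k \<Longrightarrow> irreducible_closed J (Y i)" "\<And>i. i \<le> k \<Longrightarrow> Y i \<subseteq> X"
      "\<And>i. i < k \<Longrightarrow> Y i \<subset> Y (Suc i)"
    and L: "finite L" "L \<subseteq> forms {..n} 1" "card L + c < k" for Y k L
  proof -
    \<comment> \<open>the given forms, applied to the first vector, and the equations of the diagonal\<close>
    let ?A = "(\<lambda>l z. l (\<lambda>i. z (0::nat, i))) ` L"
    let ?B = "(\<lambda>(j, i). (\<lambda>z::nat \<times> nat \<Rightarrow> complex. z (j, i)) - (\<lambda>z. z (0, i))) ` ({1..<d - 1} \<times> {..n})"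
    have "?A \<subseteq> forms J 1"
    proof
      fix f assume "f \<in> ?A"
      then obtain l where l: "l \<in> L" "f = (\<lambda>z. l (\<lambda>i. z (0, i)))" by blast
      show "f \<in> forms J 1" unfolding l(2)
        by (rule linear_form_compose[OF subsetD[OF L(2) l(1)]])
          (rule coord_in_forms, use assms(1) in \<open>auto simp: J_def\<close>)
    qed
    moreover have "?B \<subseteq> forms J 1"
    proof
      fix f assume "f \<in> ?B"
      then obtain j i where ji: "j \<in> {1..<d - 1}" "i \<le> n" "f = (\<lambda>z::nat \<times> nat \<Rightarrow> complex. z (j, i)) - (\<lambda>z. z (0, i))"
        by auto
      show "f \<in> forms J 1" unfolding ji(3)
        by (intro fs.subspace_diff[OF subspace_forms] coord_in_forms) (use ji in \<open>auto simp: J_def\<close>)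
    qed
    moreover have "card (?A \<union> ?B) < k"
    proof -
      have "card ?A \<le> card L" by (rule card_image_le[OF L(1)])
      moreover have "card ?B \<le> card ({1..<d - 1} \<times> {..n})" by (rule card_image_le) simp
      moreover have "card ({1..<d - 1} \<times> {..n}) = c"
        by (simp add: c_def card_cartesian_product numeral_2_eq_2)
      ultimately show ?thesis using L(3) card_Un_le[of ?A ?B] by linarith
    qed
    moreover have "finite J" "finite (?A \<union> ?B)" using L(1) by (simp_all add: J_def)
    ultimately obtain z where z: "z \<in> X" "\<forall>l\<in>?A \<union> ?B. l z = 0" "\<exists>v\<in>J. z v \<noteq> 0"
      using chain_length_le_cutting_forms[where Y = Y and k = k and L = "?A \<union> ?B",
          OF \<open>finite J\<close> X Y] by blast
    define x where "x = (\<lambda>i\<in>{..n}. z (0, i))"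
    have diag: "z (j, i) = x i" if "j < d - 1" "i \<le> n" for j i
    proof (cases "j = 0")
      case False
      then have "(\<lambda>z::nat \<times> nat \<Rightarrow> complex. z (j, i)) - (\<lambda>z. z (0, i)) \<in> ?B" using that by force
      then have "((\<lambda>z::nat \<times> nat \<Rightarrow> complex. z (j, i)) - (\<lambda>z. z (0, i))) z = 0" using z(2) by blast
      then show ?thesis using that by (simp add: minus_apply x_def)
    qed (use that in \<open>simp add: x_def\<close>)
    have "contraction n d T i (\<lambda>_ j. x j) = 0" if "i \<le> n" for i
    proof -
      have "contraction n d T i (\<lambda>_ j. x j) = contraction n d T i (\<lambda>k j. z (k, j))"
        unfolding contraction_def
        by (intro sum.cong refl if_cong arg_cong2[of _ _ _ _ "(*)"] prod.cong)
          (auto simp: diag multi_indices_nth)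
      then show ?thesis using z(1) that by (auto simp: X_def)
    qed
    moreover have "x \<in> affine_space {..n}" by (simp add: x_def affine_space_def)
    ultimately have "x \<in> Z" by (simp add: Z_def)
    moreover have "l x = 0" if l: "l \<in> L" for l
    proof -
      have "l x = l (\<lambda>i. z (0, i))"
        by (rule polyfuns_cong[of l "{..n}", OF subsetD[OF forms_subset_polyfuns subsetD[OF L(2) l]]])
          (simp add: x_def)
      then show ?thesis using z(2) l by auto
    qed
    moreover have "\<exists>v\<in>{..n}. x v \<noteq> 0"
      using z(3) diag by (auto simp: J_def)
    ultimately show ?thesis by blast
  qed
  have "zariski_dim J X \<le> zariski_dim {..n} Z + enat c"
    unfolding zariski_dim_def[of J X]
  proof (rule Sup_least)
    fix e assume "e \<in> {enat k | k. \<exists>Y. (\<forall>i \<le> k. irreducible_closed J (Y i) \<and> Y i \<subseteq> X) \<and>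
                          (\<forall>i < k. Y i \<subset> Y (Suc i))}"
    then obtain k Y where e: "e = enat k"
      and Y: "\<forall>i \<le> k. irreducible_closed J (Y i) \<and> Y i \<subseteq> X" "\<forall>i < k. Y i \<subset> Y (Suc i)" by blast
    show "e \<le> zariski_dim {..n} Z + enat c"
    proof (cases "k \<le> c")
      case True
      then have "e \<le> 0 + enat c" using e by simp
      also have "\<dots> \<le> zariski_dim {..n} Z + enat c" by (rule add_right_mono) simp
      finally show ?thesis .
    next
      case False
      define s where "s = k - c - 1"
      have k: "k = Suc s + c" using False by (simp add: s_def)
      have "\<exists>Y. (\<forall>i\<le>Suc s. irreducible_closed {..n} (Y i) \<and> Y i \<subseteq> Z) \<and> (\<forall>i<Suc s. Y i \<subset> Y (Suc i))"
      proof (rule chain_of_uncuttable_cone[OF finite_atMost Z])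
        fix L :: "((nat \<Rightarrow> complex) \<Rightarrow> complex) set"
        assume "finite L" "L \<subseteq> forms {..n} 1" "card L \<le> s"
        then show "\<exists>x\<in>Z. (\<forall>l\<in>L. l x = 0) \<and> (\<exists>v\<in>{..n}. x v \<noteq> 0)"
          using Y k by (intro cut[of k Y L]) auto
      qed
      then obtain Y' where "\<forall>i\<le>Suc s. irreducible_closed {..n} (Y' i) \<and> Y' i \<subseteq> Z"
          "\<forall>i<Suc s. Y' i \<subset> Y' (Suc i)" by blast
      then have "enat (Suc s) \<le> zariski_dim {..n} Z" by (rule zariski_dim_geI)
      then have "enat (Suc s) + enat c \<le> zariski_dim {..n} Z + enat c" by (rule add_right_mono)
      then show ?thesis by (simp add: e k)
    qed
  qed
  moreover have "card J = card {..n} + c"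
  proof -
    have "d - 1 = Suc (d - 2)" using assms(1) by simp
    then show ?thesis by (simp add: J_def c_def card_cartesian_product)
  qed
  ultimately have "zariski_codim {..n} Z \<le> zariski_codim J X" by (rule zariski_codim_mono)
  then show ?thesis
    unfolding sgr_def geometric_rank_def Z_eq[symmetric] J_def[symmetric] X_eq[symmetric] .
qed

end
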